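(* Suppose $F\in\mathbb{P}(\mathbb{Z}^+)$ satisfies $F(k)=\sum_{j=1}^Nc_jk^{-1-\alpha_j}+P(k)$ for all $k\in\mathbb{N}$, where $N\in\mathbb{N}$, $0<\alpha_1<\cdots<\alpha_N<1$, $c_1,\dots,c_N>0$, and $P\in L^1(\mathbb{Z}^+)$ with $\sum_{k\ge1}k|P(k)|<\infty$. Then $F$ is aperiodic and there exist $\varepsilon\in(0,1)$, $c>0$ with $1-\mathrm{Re}\,\widehat{F}(\xi)\ge\varepsilon|\xi|^{\alpha_1}$ for all $\xi\in[-\varepsilon,\varepsilon]$ and $|\partial_\xi\widehat{F}(\xi)|\le c|\xi|^{\alpha_1-1}$ for all $\xi\in[-\pi,\pi]\setminus\{0\}$. Consequently $F\in\mathcal{A}$.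
   Context: $L^1(\mathbb{Z}^+)$ is the set of summable $F:\mathbb{Z}\to\mathbb{C}$ vanishing on negative integers; $\mathbb{P}(\mathbb{Z}^+)$ those with $F\ge0$, $\sum F=1$. $\widehat{F}(\xi)=\sum_kF(k)e^{-ik\xi}$. $F$ is adapted if $\mathrm{supp}(F)$ generates the group $\mathbb{Z}$, aperiodic if every translate $\delta_m*F$ ($m\in\mathbb{Z}$) is adapted. $F^{(n)}$ is the $n$-th convolution power and $\mathcal{A}=\{F\in\mathbb{P}(\mathbb{Z}^+):\sup_{n\in\mathbb{N}}n\sum_k|F^{(n)}(k)-F^{(n+1)}(k)|<\infty\}$. *)

theory Defs
  imports "HOL-Analysis.Analysis"
begin

definition L1_Zplus :: "(int \<Rightarrow> complex) \<Rightarrow> bool" where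
  "L1_Zplus P \<longleftrightarrow> (\<forall>k<0. P k = 0) \<and> (\<lambda>k. norm (P k)) summable_on UNIV"

definition prob_Zplus :: "(int \<Rightarrow> real) \<Rightarrow> bool" where
  "prob_Zplus F \<longleftrightarrow> (\<forall>k<0. F k = 0) \<and> (\<forall>k. F k \<ge> 0) \<and> (F has_sum 1) UNIV"

definition fourier :: "(int \<Rightarrow> real) \<Rightarrow> real \<Rightarrow> complex" where
  "fourier F \<xi> = (\<Sum>\<^sub>\<infinity>k. complex_of_real (F k) * exp (- \<i> * of_int k * of_real \<xi>))"

definition conv :: "(int \<Rightarrow> real) \<Rightarrow> (int \<Rightarrow> real) \<Rightarrow> int \<Rightarrow> real" where
  "conv f g k = (\<Sum>\<^sub>\<infinity>j. f j * g (k - j))"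

definition delta :: "int \<Rightarrow> int \<Rightarrow> real" where
  "delta m k = (if k = m then 1 else 0)"

fun conv_pow :: "(int \<Rightarrow> real) \<Rightarrow> nat \<Rightarrow> int \<Rightarrow> real" where
  "conv_pow F 0 = delta 0"
| "conv_pow F (Suc n) = conv (conv_pow F n) F"

definition adapted :: "(int \<Rightarrow> real) \<Rightarrow> bool" where
  "adapted F \<longleftrightarrow> (\<forall>H::int set. 0 \<in> H \<and> (\<forall>a\<in>H. \<forall>b\<in>H. a - b \<in> H) \<and> {k. F k \<noteq> 0} \<subseteq> H
                      \<longrightarrow> H = UNIV)"

definition aperiodic :: "(int \<Rightarrow> real) \<Rightarrow> bool" where
  "aperiodic F \<longleftrightarrow> (\<forall>m. adapted (conv (delta m) F))"

definition classA :: "(int \<Rightarrow> real) set" where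
  "classA = {F. prob_Zplus F \<and>
     (\<exists>C. \<forall>n. real n * (\<Sum>\<^sub>\<infinity>k. \<bar>conv_pow F n k - conv_pow F (Suc n) k\<bar>) \<le> C)}"

end

theory Submission
  imports Defs
begin

text \<open>
  Write \<open>\<phi>\<close> for the Fourier transform of \<open>F\<close> and \<open>\<alpha>\<close> for \<open>\<alpha> 1\<close>. Up to an absolutely summable error,
  \<open>k * F k\<close> is a decreasing sequence of order \<open>k powr (- \<alpha>)\<close>. Abel summation therefore gives
  \<open>\<bar>\<phi>'(x)\<bar> \<le> C * \<bar>x\<bar> powr (\<alpha> - 1)\<close>, and the summands with \<open>k \<le> 1 / \<bar>x\<bar>\<close> give the lower bound for
  \<open>1 - Re \<phi>\<close>. Two consecutive integers must lie in the support of \<open>F\<close>, so \<open>F\<close> is aperiodic,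
  \<open>\<bar>\<phi>\<bar> < 1\<close> off the origin, and altogether \<open>\<bar>\<phi>(x)\<bar> \<le> exp (- \<kappa> * \<bar>x\<bar> powr \<alpha>)\<close>.

  For the last claim, let \<open>f\<close> be the difference of consecutive convolution powers, with transform
  \<open>g = \<phi> ^ n * (1 - \<phi>)\<close>. As \<open>g'\<close> need not be square integrable when \<open>\<alpha> \<le> 1 / 2\<close>, the
  \<open>l1\<close> norm is not estimated by the norms of \<open>g\<close> and \<open>g'\<close>. Instead, coefficients below
  \<open>K = n powr (1 / \<alpha>)\<close> are bounded by the integral of \<open>\<bar>g\<bar>\<close>, and those above it, as in Bernstein's
  theorem, by Bessel's inequality on dyadic blocks for the differences \<open>g(x + h) - g(x - h)\<close>, using
  \<open>\<bar>g'(x)\<bar> \<le> C * n powr (- 1 / 2) * \<bar>x\<bar> powr (\<alpha> / 2 - 1)\<close>. Each part is of order \<open>1 / n\<close>.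
\<close>

subsection \<open>Fourier coefficients and Bessel's inequality\<close>

text \<open>Stated with \<open>suminf\<close> over \<open>nat\<close> instead of
  \<open>infsum\<close> over \<open>int\<close>, so that the M-test, Cauchy products and termwise
  differentiation apply; \<open>fourier_eq_fourier_nat\<close> makes the link to
  \<open>fourier\<close>.\<close>

definition fourier_nat :: "(nat \<Rightarrow> complex) \<Rightarrow> real \<Rightarrow> complex" where
  "fourier_nat f x = (\<Sum>k. f k * cis (- (real k * x)))"

lemma summable_fourier_nat:
  fixes f :: "nat \<Rightarrow> complex"
  assumes "summable (\<lambda>k. norm (f k))"
  shows "summable (\<lambda>k. f k * cis (- (real k * x)))"
  by (rule summable_norm_cancel) (use assms in \<open>simp add: norm_mult\<close>)

lemma fourier_nat_uniform_limit:
  fixes f :: "nat \<Rightarrow> complex"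
  assumes "summable (\<lambda>k. norm (f k))"
  shows "uniform_limit A (\<lambda>n x. \<Sum>k<n. f k * cis (- (real k * x))) (fourier_nat f) sequentially"
  unfolding fourier_nat_def
  by (rule Weierstrass_m_test[OF _ assms]) (simp add: norm_mult)

lemma continuous_on_fourier_nat:
  fixes f :: "nat \<Rightarrow> complex"
  assumes "summable (\<lambda>k. norm (f k))"
  shows "continuous_on A (fourier_nat f)"
  by (rule uniform_limit_theorem[OF _ fourier_nat_uniform_limit[OF assms]])
     (auto intro!: always_eventually continuous_intros)

lemma has_integral_cis_int:
  "((\<lambda>x. cis (of_int m * x)) has_integral (if m = 0 then 2 * pi else 0)) {-pi..pi}"
proof (cases "m = 0")
  case True
  show ?thesis using has_integral_const_real[of "1::complex" "-pi" pi] True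
    by (simp add: scaleR_conv_of_real)
next
  case False
  have deriv: "((\<lambda>x. cis (of_int m * x) / (\<i> * of_int m)) has_vector_derivative cis (of_int m * x))
          (at x within {-pi..pi})" for x
  proof -
    have "((\<lambda>z. exp (\<i> * of_int m * z) / (\<i> * of_int m)) has_field_derivative
        exp (\<i> * of_int m * of_real x)) (at (of_real x))"
      using False by (auto intro!: derivative_eq_intros)
    from has_vector_derivative_real_field[OF this, of "{-pi..pi}"]
    show ?thesis by (simp add: cis_conv_exp mult.assoc)
  qed
  have "((\<lambda>x. cis (of_int m * x)) has_integral
        (cis (of_int m * pi) / (\<i> * of_int m) - cis (of_int m * (-pi)) / (\<i> * of_int m))) {-pi..pi}"
    by (rule fundamental_theorem_of_calculus[OF _ deriv]) simp
  moreover have "cis (of_int m * pi) = cis (of_int m * (-pi))"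
  proof -
    have "sin (of_int m * pi) = 0"
      by (simp add: sin_zero_iff_int2)
    then show ?thesis by (simp add: complex_eq_iff)
  qed
  ultimately show ?thesis using False by simp
qed

text \<open>Uniform convergence permits termwise integration. By orthogonality the integral of a
  partial sum no longer changes once the partial sum contains index \<open>k\<close>.\<close>

lemma fourier_nat_coefficient:
  fixes f :: "nat \<Rightarrow> complex"
  assumes f: "summable (\<lambda>k. norm (f k))"
  shows "((\<lambda>x. fourier_nat f x * cis (real k * x)) has_integral (2 * pi * f k)) {-pi..pi}"
proof -
  let ?S = "\<lambda>n x. (\<Sum>j<n. f j * cis (- (real j * x))) * cis (real k * x)"
  have lim: "uniform_limit {-pi..pi} ?S (\<lambda>x. fourier_nat f x * cis (real k * x)) sequentially"
  proof (rule uniform_lim_mult[OF fourier_nat_uniform_limit[OF f] uniform_limit_const])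
    show "bounded (fourier_nat f ` {- pi..pi})"
      by (intro compact_imp_bounded compact_continuous_image continuous_on_fourier_nat f) auto
    show "bounded ((\<lambda>x. cis (real k * x)) ` {- pi..pi})"
      by (intro compact_imp_bounded compact_continuous_image continuous_intros) auto
  qed
  obtain I J where IJ: "\<And>n. (?S n has_integral I n) {-pi..pi}"
      "((\<lambda>x. fourier_nat f x * cis (real k * x)) has_integral J) {-pi..pi}" "I \<longlonglongrightarrow> J"
    by (rule uniform_limit_integral[OF lim]) (auto intro!: continuous_intros)
  have "I n = 2 * pi * f k" if "n > k" for n
  proof -
    have "((\<lambda>x. \<Sum>j<n. f j * cis (of_int (int k - int j) * x)) has_integral
          (\<Sum>j<n. f j * (if int k - int j = 0 then 2 * pi else 0))) {-pi..pi}"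
      by (intro has_integral_sum has_integral_mult_right has_integral_cis_int) auto
    also have "(\<lambda>x. \<Sum>j<n. f j * cis (of_int (int k - int j) * x)) = ?S n"
      by (auto simp: fun_eq_iff sum_distrib_right cis_mult mult.assoc left_diff_distrib intro!: sum.cong)
    also have "(\<Sum>j<n. f j * (if int k - int j = 0 then 2 * pi else 0)) =
        (\<Sum>j<n. if j = k then f j * (2 * pi) else 0)"
      by (rule sum.cong) auto
    also have "\<dots> = 2 * pi * f k"
      using that by (simp add: sum.delta)
    finally show ?thesis by (rule has_integral_unique[OF IJ(1)])
  qed
  then have "eventually (\<lambda>n. I n = 2 * pi * f k) sequentially"
    unfolding eventually_at_top_dense by blast
  then have "I \<longlonglongrightarrow> 2 * pi * f k" by (rule tendsto_eventually)
  then have "J = 2 * pi * f k" using IJ(3) LIMSEQ_unique by blast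
  then show ?thesis using IJ(2) by simp
qed

lemma fourier_nat_coefficient_bound:
  fixes f :: "nat \<Rightarrow> complex"
  assumes f: "summable (\<lambda>k. norm (f k))"
  shows "2 * pi * norm (f k) \<le> integral {-pi..pi} (\<lambda>x. norm (fourier_nat f x))"
proof -
  have "norm (integral {-pi..pi} (\<lambda>x. fourier_nat f x * cis (real k * x)))
      \<le> integral {-pi..pi} (\<lambda>x. norm (fourier_nat f x))"
    by (rule integral_norm_bound_integral)
       (auto simp: norm_mult intro!: integrable_continuous_real continuous_intros continuous_on_fourier_nat f)
  then show ?thesis
    using integral_unique[OF fourier_nat_coefficient[OF f, of k]] by (simp add: norm_mult)
qed

text \<open>Each term of the conjugated finite section picks out one coefficient of the
  transform.\<close>

lemma fourier_nat_pairing: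
  fixes f :: "nat \<Rightarrow> complex"
  assumes f: "summable (\<lambda>k. norm (f k))" and A: "finite A"
  shows "((\<lambda>x. fourier_nat f x * cnj (\<Sum>k\<in>A. f k * cis (- (real k * x)))) has_integral
           (2 * pi * (\<Sum>k\<in>A. (norm (f k))\<^sup>2))) {-pi..pi}"
proof -
  have "((\<lambda>x. \<Sum>k\<in>A. cnj (f k) * (fourier_nat f x * cis (real k * x))) has_integral
          (\<Sum>k\<in>A. cnj (f k) * (2 * pi * f k))) {-pi..pi}"
    by (intro has_integral_sum A has_integral_mult_right fourier_nat_coefficient f)
  also have "(\<lambda>x. \<Sum>k\<in>A. cnj (f k) * (fourier_nat f x * cis (real k * x))) =
     (\<lambda>x. fourier_nat f x * cnj (\<Sum>k\<in>A. f k * cis (- (real k * x))))"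
    by (auto simp: fun_eq_iff sum_distrib_left cis_cnj mult_ac)
  also have "(\<Sum>k\<in>A. cnj (f k) * (2 * pi * f k)) = 2 * pi * (\<Sum>k\<in>A. (norm (f k))\<^sup>2)"
    by (simp add: sum_distrib_left complex_norm_square mult_ac del: of_real_power)
  finally show ?thesis by simp
qed

text \<open>Expand the nonnegative integral of the squared distance between the transform and its
  finite section \<open>S\<close>: the cross term and the square of \<open>S\<close> both integrate
  to \<open>s\<close>.\<close>

lemma bessel_inequality:
  fixes f :: "nat \<Rightarrow> complex"
  assumes f: "summable (\<lambda>k. norm (f k))" and A: "finite A"
  shows "2 * pi * (\<Sum>k\<in>A. (norm (f k))\<^sup>2) \<le> integral {-pi..pi} (\<lambda>x. (norm (fourier_nat f x))\<^sup>2)"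
proof -
  define S where "S x = (\<Sum>k\<in>A. f k * cis (- (real k * x)))" for x
  define s where "s = 2 * pi * (\<Sum>k\<in>A. (norm (f k))\<^sup>2)"
  \<comment> \<open>\<open>S\<close> is itself the transform of the truncated sequence, so the
    pairing lemma also evaluates the integral of its square.\<close>
  let ?fA = "\<lambda>k. if k \<in> A then f k else 0"
  have S_eq: "fourier_nat ?fA = S"
    unfolding fourier_nat_def S_def fun_eq_iff
    by (subst suminf_finite[OF A]) auto
  have fA: "summable (\<lambda>k. norm (?fA k))"
    by (rule summable_finite[OF A]) auto
  have 1: "((\<lambda>x. Re (fourier_nat f x * cnj (S x))) has_integral s) {-pi..pi}"
    using has_integral_Re[OF fourier_nat_pairing[OF f A]] by (simp add: S_def s_def)
  have S': "(\<Sum>k\<in>A. ?fA k * cis (- (real k * x))) = S x" for x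
    by (simp add: S_def)
  have 2: "((\<lambda>x. Re (S x * cnj (S x))) has_integral s) {-pi..pi}"
    using has_integral_Re[OF fourier_nat_pairing[OF fA A]]
    by (simp only: S_eq S') (simp add: s_def)
  have contg: "continuous_on {-pi..pi} (fourier_nat f)" by (rule continuous_on_fourier_nat[OF f])
  have contS: "continuous_on {-pi..pi} S" unfolding S_def by (intro continuous_intros)
  have 3: "((\<lambda>x. (norm (fourier_nat f x))\<^sup>2) has_integral
      integral {-pi..pi} (\<lambda>x. (norm (fourier_nat f x))\<^sup>2)) {-pi..pi}"
    by (intro integrable_integral integrable_continuous_real continuous_intros contg)
  have "((\<lambda>x. (norm (fourier_nat f x))\<^sup>2 - 2 * Re (fourier_nat f x * cnj (S x)) + Re (S x * cnj (S x)))
      has_integral (integral {-pi..pi} (\<lambda>x. (norm (fourier_nat f x))\<^sup>2) - 2 * s + s)) {-pi..pi}"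
    by (intro has_integral_add has_integral_diff has_integral_mult_right 1 2 3)
  moreover have "(norm (fourier_nat f x))\<^sup>2 - 2 * Re (fourier_nat f x * cnj (S x)) + Re (S x * cnj (S x))
      = (norm (fourier_nat f x - S x))\<^sup>2" for x
    unfolding cmod_power2 by (simp add: power2_eq_square algebra_simps)
  ultimately have "((\<lambda>x. (norm (fourier_nat f x - S x))\<^sup>2)
      has_integral (integral {-pi..pi} (\<lambda>x. (norm (fourier_nat f x))\<^sup>2) - 2 * s + s)) {-pi..pi}"
    by simp
  then have "0 \<le> integral {-pi..pi} (\<lambda>x. (norm (fourier_nat f x))\<^sup>2) - 2 * s + s"
    by (rule has_integral_nonneg) simp
  then show ?thesis by (simp add: s_def)
qed

subsection \<open>Functions with a singular derivative at the origin\<close>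

lemma has_vector_derivative_reflect:
  fixes g :: "real \<Rightarrow> 'a::real_normed_vector"
  assumes "(g has_vector_derivative D) (at (- x))"
  shows "((\<lambda>x. g (- x)) has_vector_derivative - D) (at x)"
proof -
  have "((g \<circ> uminus) has_vector_derivative (-1) *\<^sub>R D) (at x)"
    by (rule vector_diff_chain_at) (use assms in \<open>auto intro!: derivative_eq_intros\<close>)
  then show ?thesis by (simp add: o_def)
qed

text \<open>Used twice: for \<open>\<phi>\<close> with \<open>s = \<alpha>\<close>, and for
  differences of consecutive powers of \<open>\<phi>\<close> with \<open>s = \<alpha> / 2\<close>
  and \<open>M\<close> of order \<open>n powr (- 1 / 2)\<close>. The condition \<open>0 < s\<close>
  makes the singularity of the bound integrable.\<close>

locale singular_derivative =
  fixes g g' :: "real \<Rightarrow> complex" and M s R :: real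
  assumes cont: "continuous_on UNIV g"
    and deriv: "\<And>x. x \<noteq> 0 \<Longrightarrow> \<bar>x\<bar> < R \<Longrightarrow> (g has_vector_derivative g' x) (at x)"
    and bound: "\<And>x. x \<noteq> 0 \<Longrightarrow> \<bar>x\<bar> < R \<Longrightarrow> norm (g' x) \<le> M * \<bar>x\<bar> powr (s - 1)"
    and s: "0 < s" "s < 1" and M: "M \<ge> 0"
begin

text \<open>Lets the estimates below be proved for nonnegative arguments only.\<close>

lemma reflect: "singular_derivative (\<lambda>x. g (- x)) (\<lambda>x. - g' (- x)) M s R"
proof
  show "continuous_on UNIV (\<lambda>x. g (- x))"
    by (rule continuous_on_compose2[OF cont]) (auto intro!: continuous_intros)
  fix x :: real assume "x \<noteq> 0" "\<bar>x\<bar> < R"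
  then show "((\<lambda>x. g (- x)) has_vector_derivative - g' (- x)) (at x)"
    by (intro has_vector_derivative_reflect deriv) auto
  show "norm (- g' (- x)) \<le> M * \<bar>x\<bar> powr (s - 1)"
    using bound[of "- x"] \<open>x \<noteq> 0\<close> \<open>\<bar>x\<bar> < R\<close> by auto
qed (rule s M)+

text \<open>Comparison with the primitive \<open>M / s * x powr s\<close> of the derivative bound.
  Derivatives are needed only in the open interval, so the singularity at \<open>0\<close> does no
  harm.\<close>

lemma holder_at_zero_pos:
  assumes y: "0 \<le> y" "y < R"
  shows "norm (g y - g 0) \<le> M / s * y powr s"
proof (cases "y = 0")
  case False
  have "norm (g y - g 0) \<le> M / s * y powr s - M / s * 0 powr s"
  proof (rule differentiable_bound_general[where f' = g' and \<phi>' = "\<lambda>x. M * x powr (s - 1)"])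
    show "0 < y" using False y by simp
    show "continuous_on {0..y} g" using cont continuous_on_subset by blast
    show "continuous_on {0..y} (\<lambda>x. M / s * x powr s)"
      using s by (intro continuous_intros continuous_on_powr') auto
    fix x assume x: "0 < x" "x < y"
    show "((\<lambda>x. M / s * x powr s) has_vector_derivative M * x powr (s - 1)) (at x)"
      unfolding has_real_derivative_iff_has_vector_derivative[symmetric]
      using x s by (auto intro!: derivative_eq_intros)
    show "(g has_vector_derivative g' x) (at x)" "norm (g' x) \<le> M * x powr (s - 1)"
      using deriv[of x] bound[of x] x y by auto
  qed
  then show ?thesis by simp
qed simp

lemma holder_at_zero:
  assumes "\<bar>y\<bar> < R"
  shows "norm (g y - g 0) \<le> M / s * \<bar>y\<bar> powr s"
proof (cases "y \<ge> 0")
  case True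
  then show ?thesis using holder_at_zero_pos[of y] assms by simp
next
  case False
  interpret r: singular_derivative "\<lambda>x. g (- x)" "\<lambda>x. - g' (- x)" M s R by (rule reflect)
  show ?thesis using r.holder_at_zero_pos[of "- y"] False assms by simp
qed

text \<open>Away from the origin this is the mean value estimate; within distance \<open>2 * h\<close> of it,
  the two values are compared with \<open>g 0\<close> instead.\<close>

lemma symmetric_difference_bound_pos:
  assumes h: "0 < h" and x: "0 \<le> x" "x + h < R"
  shows "norm (g (x + h) - g (x - h)) \<le> 6 * M / s * h * (x + h) powr (s - 1)"
proof (cases "x \<le> 2 * h")
  case True
  have "norm (g (x + h) - g (x - h)) \<le> norm (g (x + h) - g 0) + norm (g (x - h) - g 0)"
    by (metis diff_diff_eq2 diff_add_cancel norm_triangle_ineq4)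
  also have "\<dots> \<le> M / s * \<bar>x + h\<bar> powr s + M / s * \<bar>x - h\<bar> powr s"
    by (intro add_mono holder_at_zero) (use x h in auto)
  also have "\<dots> \<le> M / s * (x + h) powr s + M / s * (x + h) powr s"
    by (intro add_mono mult_left_mono powr_mono2) (use x h s M in auto)
  also have "\<dots> = 2 * M / s * ((x + h) * (x + h) powr (s - 1))"
    using x h by (simp add: powr_diff)
  \<comment> \<open>Here \<open>x + h \<le> 3 * h\<close>, which trades one power of
    \<open>x + h\<close> for the desired factor \<open>h\<close>.\<close>
  also have "\<dots> \<le> 2 * M / s * ((3 * h) * (x + h) powr (s - 1))"
    by (intro mult_left_mono mult_right_mono) (use True M s in auto)
  finally show ?thesis by simp
next
  case False
  \<comment> \<open>Since \<open>x > 2 * h\<close>, already the left end \<open>x - h\<close>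
    exceeds \<open>(x + h) / 3\<close>, so on the whole interval the derivative bound is within a
    factor \<open>3\<close> of its value at \<open>x + h\<close>.\<close>
  have in_dom: "y > 0" "y < R" "(x + h) / 3 \<le> y" if "y \<in> {x - h..x + h}" for y
    using that False h x by auto
  have "norm (g (x + h) - g (x - h)) \<le> (3 * M * (x + h) powr (s - 1)) * norm ((x + h) - (x - h))"
  proof (rule differentiable_bound[of "{x - h..x + h}" g "\<lambda>y t. t *\<^sub>R g' y"])
    fix y assume y: "y \<in> {x - h..x + h}"
    note d = in_dom[OF y]
    show "(g has_derivative (\<lambda>t. t *\<^sub>R g' y)) (at y within {x - h..x + h})"
      using deriv[of y] d unfolding has_vector_derivative_def by (auto intro: has_derivative_at_withinI)
    have "onorm (\<lambda>t. t *\<^sub>R g' y) \<le> norm (g' y)"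
      by (rule onorm_le) (simp add: mult.commute)
    also have "\<dots> \<le> M * y powr (s - 1)" using bound[of y] d by auto
    also have "\<dots> \<le> M * ((x + h) / 3) powr (s - 1)"
      using d s M x h by (intro mult_left_mono powr_mono2') auto
    also have "\<dots> = M * (x + h) powr (s - 1) * 3 powr (1 - s)"
      using x h by (simp add: powr_divide powr_diff powr_minus field_simps)
    also have "\<dots> \<le> M * (x + h) powr (s - 1) * 3 powr 1"
      using s M by (intro mult_left_mono powr_mono) auto
    finally show "onorm (\<lambda>t. t *\<^sub>R g' y) \<le> 3 * M * (x + h) powr (s - 1)" by (simp add: mult_ac)
  qed (use h in auto)
  also have "\<dots> = 6 * M * h * (x + h) powr (s - 1)" using h by simp
  also have "\<dots> \<le> 6 * M / s * h * (x + h) powr (s - 1)"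
    using s M h by (intro mult_right_mono) (auto simp: field_simps mult_left_le)
  finally show ?thesis .
qed

lemma symmetric_difference_bound:
  assumes h: "0 < h" and x: "\<bar>x\<bar> + h < R"
  shows "norm (g (x + h) - g (x - h)) \<le> 6 * M / s * h * (\<bar>x\<bar> + h) powr (s - 1)"
proof (cases "x \<ge> 0")
  case True
  then show ?thesis using symmetric_difference_bound_pos[OF h, of x] x by auto
next
  case False
  interpret r: singular_derivative "\<lambda>x. g (- x)" "\<lambda>x. - g' (- x)" M s R by (rule reflect)
  show ?thesis
    using r.symmetric_difference_bound_pos[OF h, of "- x"] False x
    by (simp add: norm_minus_commute add.commute)
qed

end

subsection \<open>Bernstein's bound for absolute convergence\<close>

text \<open>A symmetric difference acts on the coefficients as the multiplier
  \<open>- 2 * \<i> * sin (k * h)\<close>. Its size is bounded below on a dyadic block once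
  \<open>h\<close> is matched to the block.\<close>

lemma fourier_nat_symmetric_difference:
  fixes f :: "nat \<Rightarrow> complex"
  assumes f: "summable (\<lambda>k. norm (f k))"
  shows "fourier_nat f (x + h) - fourier_nat f (x - h) =
      fourier_nat (\<lambda>k. - 2 * \<i> * sin (real k * h) * f k) x"
proof -
  have "fourier_nat f (x + h) - fourier_nat f (x - h) =
      (\<Sum>k. f k * cis (- (real k * (x + h))) - f k * cis (- (real k * (x - h))))"
    unfolding fourier_nat_def
    by (rule suminf_diff) (intro summable_fourier_nat f)+
  also have "\<dots> = (\<Sum>k. (- 2 * \<i> * sin (real k * h) * f k) * cis (- (real k * x)))"
  proof (rule suminf_cong)
    fix k
    have "cis (- (real k * (x + h))) - cis (- (real k * (x - h))) =
        cis (- (real k * x)) * (cis (- (real k * h)) - cis (real k * h))"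
      by (simp add: right_diff_distrib distrib_left cis_mult)
    also have "cis (- (real k * h)) - cis (real k * h) = - 2 * \<i> * sin (real k * h)"
      by (simp add: complex_eq_iff)
    finally show "f k * cis (- (real k * (x + h))) - f k * cis (- (real k * (x - h))) =
        (- 2 * \<i> * sin (real k * h) * f k) * cis (- (real k * x))"
      by (simp add: right_diff_distrib[symmetric] mult_ac)
  qed
  finally show ?thesis unfolding fourier_nat_def .
qed

text \<open>As \<open>s < 1 / 2\<close>, the exponent \<open>2 * s - 2\<close> lies below
  \<open>-1\<close>: the mass sits near \<open>0\<close> at scale \<open>h\<close>, and the bound
  does not depend on \<open>b\<close>.\<close>

lemma integral_shifted_powr_le:
  fixes h s b :: real
  assumes "0 < h" "0 < s" "s < 1 / 2" "0 \<le> b"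
  shows "(\<lambda>x. (\<bar>x\<bar> + h) powr (2 * s - 2)) integrable_on {-b..b}"
    and "integral {-b..b} (\<lambda>x. (\<bar>x\<bar> + h) powr (2 * s - 2)) \<le> 2 * h powr (2 * s - 1) / (1 - 2 * s)"
proof -
  let ?w = "\<lambda>x. (\<bar>x\<bar> + h) powr (2 * s - 2)"
  define I where "I = (b + h) powr (2 * s - 1) / (2 * s - 1) - (0 + h) powr (2 * s - 1) / (2 * s - 1)"
  have "((\<lambda>x. (x + h) powr (2 * s - 2)) has_integral I) {0..b}"
    unfolding I_def
  proof (rule fundamental_theorem_of_calculus)
    fix x assume "x \<in> {0..b}"
    then show "((\<lambda>x. (x + h) powr (2 * s - 1) / (2 * s - 1)) has_vector_derivative (x + h) powr (2 * s - 2))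
        (at x within {0..b})"
      unfolding has_real_derivative_iff_has_vector_derivative[symmetric]
      using assms by (auto intro!: derivative_eq_intros)
  qed fact
  then have pos: "(?w has_integral I) {0..b}"
    by (rule has_integral_eq[rotated]) auto
  then have "((\<lambda>x. ?w (- x)) has_integral I) {-b..-0}"
    by (subst has_integral_reflect_real)
  then have neg: "(?w has_integral I) {-b..0}" by simp
  have int: "(?w has_integral (I + I)) {-b..b}"
    by (rule has_integral_combine[OF _ _ neg pos]) (use assms in auto)
  then show "?w integrable_on {-b..b}" by blast
  have "I \<le> h powr (2 * s - 1) / (1 - 2 * s)"
  proof -
    have "I = (h powr (2 * s - 1) - (b + h) powr (2 * s - 1)) / (1 - 2 * s)"
      unfolding I_def using assms by (simp add: divide_simps) (simp add: algebra_simps)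
    also have "\<dots> \<le> h powr (2 * s - 1) / (1 - 2 * s)"
      using assms by (intro divide_right_mono) auto
    finally show ?thesis .
  qed
  then show "integral {-b..b} ?w \<le> 2 * h powr (2 * s - 1) / (1 - 2 * s)"
    using integral_unique[OF int] by simp
qed

text \<open>The radius 4 is large enough for the shifts \<open>x \<plusminus> h\<close> of points of \<open>[-\<pi>, \<pi>]\<close> by \<open>h \<le> \<pi> / 4\<close>,
  yet below the next singularity \<open>2 * \<pi>\<close>.\<close>

locale singular_fourier_nat = singular_derivative "fourier_nat f" g' M s 4
  for f :: "nat \<Rightarrow> complex" and g' M s +
  assumes summable: "summable (\<lambda>k. norm (f k))"
    and s_less_half: "s < 1 / 2"
begin

text \<open>Squaring the pointwise bound contributes
  \<open>36 * M\<^sup>2 * h\<^sup>2 / s\<^sup>2\<close>, the remaining integral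
  \<open>2 * h powr (2 * s - 1) / (1 - 2 * s)\<close>; this is where \<open>72\<close> and the
  exponent \<open>1 + 2 * s\<close> come from.\<close>

lemma integral_difference_le:
  assumes h: "0 < h" "h \<le> pi / 4"
  shows "integral {-pi..pi} (\<lambda>x. (norm (fourier_nat f (x + h) - fourier_nat f (x - h)))\<^sup>2)
           \<le> 72 * M\<^sup>2 / (s\<^sup>2 * (1 - 2 * s)) * h powr (1 + 2 * s)"
proof -
  let ?D = "\<lambda>x. norm (fourier_nat f (x + h) - fourier_nat f (x - h))"
  have pw: "(?D x)\<^sup>2 \<le> (6 * M / s * h)\<^sup>2 * (\<bar>x\<bar> + h) powr (2 * s - 2)" if "x \<in> {-pi..pi}" for x
  proof -
    have "\<bar>x\<bar> + h < 4" using that h pi_approx by auto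
    then have "?D x \<le> 6 * M / s * h * (\<bar>x\<bar> + h) powr (s - 1)"
      using h by (intro symmetric_difference_bound) auto
    then have "(?D x)\<^sup>2 \<le> (6 * M / s * h * (\<bar>x\<bar> + h) powr (s - 1))\<^sup>2"
      by (rule power_mono) simp
    also have "\<dots> = (6 * M / s * h)\<^sup>2 * (\<bar>x\<bar> + h) powr (2 * s - 2)"
    proof -
      have "((\<bar>x\<bar> + h) powr (s - 1))\<^sup>2 = (\<bar>x\<bar> + h) powr (2 * s - 2)"
        unfolding power2_eq_square powr_add[symmetric] by (simp add: algebra_simps)
      then show ?thesis by (simp only: power_mult_distrib)
    qed
    finally show ?thesis .
  qed
  have "integral {-pi..pi} (\<lambda>x. (?D x)\<^sup>2) \<le>
      integral {-pi..pi} (\<lambda>x. (6 * M / s * h)\<^sup>2 * (\<bar>x\<bar> + h) powr (2 * s - 2))"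
  proof (rule integral_le)
    show "(\<lambda>x. (?D x)\<^sup>2) integrable_on {-pi..pi}"
      by (intro integrable_continuous_real continuous_intros
          continuous_on_compose2[OF continuous_on_fourier_nat[OF summable, of UNIV]]) auto
    show "(\<lambda>x. (6 * M / s * h)\<^sup>2 * (\<bar>x\<bar> + h) powr (2 * s - 2)) integrable_on {-pi..pi}"
      by (rule integrable_on_mult_right, rule integral_shifted_powr_le) (use h s s_less_half in auto)
  qed (rule pw)
  also have "\<dots> = (6 * M / s * h)\<^sup>2 * integral {-pi..pi} (\<lambda>x. (\<bar>x\<bar> + h) powr (2 * s - 2))"
    by simp
  also have "\<dots> \<le> (6 * M / s * h)\<^sup>2 * (2 * h powr (2 * s - 1) / (1 - 2 * s))"
    by (rule mult_left_mono, rule integral_shifted_powr_le) (use h s s_less_half in auto)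
  also have "\<dots> = 72 * M\<^sup>2 / (s\<^sup>2 * (1 - 2 * s)) * (h\<^sup>2 * h powr (2 * s - 1))"
    by (simp add: power_mult_distrib power_divide)
  also have "h\<^sup>2 * h powr (2 * s - 1) = h powr (1 + 2 * s)"
    using h powr_add[of h 2 "2 * s - 1"] by simp
  finally show ?thesis .
qed

text \<open>The \<open>12\<close> is \<open>72 / 6\<close>, with \<open>6\<close> a lower bound for
  the factor \<open>2 * pi\<close> in Bessel's inequality; the root appears because that inequality
  controls squares.\<close>

definition "block_const = sqrt (12 / (s\<^sup>2 * (1 - 2 * s)))"

text \<open>Bessel's inequality for the symmetric difference bounds the sum of squares over the
  block, and Cauchy-Schwarz over its \<open>L\<close> indices passes to the sum of norms.\<close>

lemma sum_block_le:
  assumes L: "L \<ge> (1::nat)"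
  shows "(\<Sum>k=L..<2 * L. norm (f k)) \<le> block_const * M * real L powr (- s)"
proof -
  \<comment> \<open>With this \<open>h\<close>, every \<open>k\<close> in the block has
    \<open>k * h\<close> between \<open>pi / 4\<close> and \<open>pi / 2\<close>, where the sine is
    at least \<open>1 / 2\<close>.\<close>
  define h where "h = pi / (4 * real L)"
  have L0: "real L \<ge> 1" using L by simp
  have h: "0 < h" "h \<le> pi / 4" "h \<le> 1 / real L"
    unfolding h_def using L0 pi_less_4 by (auto simp: field_simps)
  define b where "b k = - 2 * \<i> * sin (real k * h) * f k" for k
  have b_le: "norm (b k) \<le> 2 * norm (f k)" for k
    using mult_right_mono[OF abs_sin_le_one[of "real k * h"], of "norm (f k)"]
    by (simp add: b_def norm_mult)
  have sb: "summable (\<lambda>k. norm (b k))"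
    by (rule summable_comparison_test'[OF summable_mult[OF summable, of 2]]) (use b_le in auto)
  have b_ge: "norm (f k) \<le> norm (b k)" if "k \<in> {L..<2 * L}" for k
  proof -
    have "real L * h = pi / 4" using L0 by (simp add: h_def)
    moreover have "real L * h \<le> real k * h" "real k * h \<le> (2 * real L) * h"
      using that h by (auto intro!: mult_right_mono)
    ultimately have "sin (pi / 4) \<le> sin (real k * h)"
      by (intro sin_monotone_2pi_le) auto
    then have "1 / 2 \<le> sin (real k * h)"
      using real_le_lsqrt[of 1 2] sqrt2_less_2 by (simp add: sin_45) (metis real_sqrt_ge_1_iff one_le_numeral order_trans)
    then have "norm (f k) * 1 \<le> norm (f k) * (2 * \<bar>sin (real k * h)\<bar>)"
      by (intro mult_left_mono) auto
    then show ?thesis by (simp add: b_def norm_mult mult_ac)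
  qed
  have "2 * pi * (\<Sum>k=L..<2 * L. (norm (f k))\<^sup>2) \<le> 2 * pi * (\<Sum>k=L..<2 * L. (norm (b k))\<^sup>2)"
    by (intro mult_left_mono sum_mono power_mono b_ge) auto
  also have "\<dots> \<le> integral {-pi..pi} (\<lambda>x. (norm (fourier_nat b x))\<^sup>2)"
    by (rule bessel_inequality[OF sb]) simp
  also have "\<dots> \<le> 72 * M\<^sup>2 / (s\<^sup>2 * (1 - 2 * s)) * h powr (1 + 2 * s)"
    using integral_difference_le[OF h(1,2)]
    unfolding fourier_nat_symmetric_difference[OF summable] b_def .
  also have "\<dots> \<le> 72 * M\<^sup>2 / (s\<^sup>2 * (1 - 2 * s)) * (1 / real L) powr (1 + 2 * s)"
    using h s s_less_half by (intro mult_left_mono powr_mono2) auto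
  finally have "6 * (\<Sum>k=L..<2 * L. (norm (f k))\<^sup>2) \<le> 72 * M\<^sup>2 / (s\<^sup>2 * (1 - 2 * s)) * (1 / real L) powr (1 + 2 * s)"
    using mult_right_mono[of 6 "2 * pi" "\<Sum>k=L..<2 * L. (norm (f k))\<^sup>2"] pi_gt3
    by (auto simp: sum_nonneg)
  then have sq: "(\<Sum>k=L..<2 * L. (norm (f k))\<^sup>2) \<le> 12 / (s\<^sup>2 * (1 - 2 * s)) * M\<^sup>2 * (1 / real L) powr (1 + 2 * s)"
    by simp
  have "(\<Sum>k=L..<2 * L. norm (f k))\<^sup>2 \<le> (\<Sum>k=L..<2 * L. (norm (f k))\<^sup>2) * real (card {L..<2 * L})"
    by (rule sum_squared_le_sum_of_squares)
  also have "\<dots> \<le> 12 / (s\<^sup>2 * (1 - 2 * s)) * M\<^sup>2 * (1 / real L) powr (1 + 2 * s) * real L"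
    using mult_right_mono[OF sq, of "real L"] by simp
  also have "\<dots> = block_const\<^sup>2 * M\<^sup>2 * ((1 / real L) powr (1 + 2 * s) * real L)"
    using s s_less_half by (simp add: block_const_def)
  also have "(1 / real L) powr (1 + 2 * s) * real L = (real L powr (- s))\<^sup>2"
  proof -
    have "(1 / real L) powr (1 + 2 * s) = real L powr (- 1 - 2 * s)"
      using L0 by (simp add: powr_divide powr_minus_divide[symmetric])
    then have "(1 / real L) powr (1 + 2 * s) * real L = real L powr (- 1 - 2 * s) * real L powr 1"
      using L0 by simp
    also have "\<dots> = real L powr (- s + - s)"
      unfolding powr_add[symmetric] by simp
    finally show ?thesis by (simp only: powr_add power2_eq_square)
  qed
  also have "block_const\<^sup>2 * M\<^sup>2 * (real L powr (- s))\<^sup>2 = (block_const * M * real L powr (- s))\<^sup>2"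
    by (simp add: power_mult_distrib)
  finally show ?thesis
    by (rule power2_le_imp_le) (use s s_less_half M in \<open>simp add: block_const_def\<close>)
qed

text \<open>The block bounds starting at \<open>2 ^ j * K\<close> form a geometric series of ratio
  \<open>2 powr (- s)\<close>. The bound is uniform in \<open>n\<close>.\<close>

lemma sum_tail_le:
  assumes K: "K \<ge> (1::nat)"
  shows "(\<Sum>k=K..<n. norm (f k)) \<le> block_const / (1 - 2 powr (- s)) * M * real K powr (- s)"
proof -
  define r where "r = 2 powr (- s)"
  have r: "0 < r" "r < 1" using s by (auto simp: r_def powr_less_one)
  have dyadic: "(\<Sum>k=K..<2 ^ J * K. norm (f k)) \<le> (\<Sum>j<J. block_const * M * real K powr (- s) * r ^ j)" for J
  proof (induction J)
    case (Suc J)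
    have "K \<le> 2 ^ J * K" by simp
    then have "{K..<2 ^ Suc J * K} = {K..<2 ^ J * K} \<union> {2 ^ J * K..<2 * (2 ^ J * K)}"
      unfolding power_Suc mult.assoc by (intro ivl_disj_un_two(3)[symmetric]) auto
    then have "(\<Sum>k=K..<2 ^ Suc J * K. norm (f k)) =
        (\<Sum>k=K..<2 ^ J * K. norm (f k)) + (\<Sum>k=2 ^ J * K..<2 * (2 ^ J * K). norm (f k))"
      by (simp add: sum.union_disjoint)
    also have "(\<Sum>k=2 ^ J * K..<2 * (2 ^ J * K). norm (f k)) \<le> block_const * M * real (2 ^ J * K) powr (- s)"
      by (rule sum_block_le) (use K in auto)
    also have "real (2 ^ J * K) powr (- s) = real K powr (- s) * r ^ J"
      by (simp add: r_def powr_mult powr_realpow[symmetric] powr_powr mult.commute)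
    finally show ?case using Suc by (simp add: mult.assoc)
  qed simp
  \<comment> \<open>A crude count: \<open>n\<close> dyadic blocks certainly reach beyond
    \<open>n\<close>.\<close>
  have "n \<le> 2 ^ n * K" using K
    by (metis less_exp less_imp_le mult.right_neutral mult_le_mono)
  then have "(\<Sum>k=K..<n. norm (f k)) \<le> (\<Sum>k=K..<2 ^ n * K. norm (f k))"
    by (intro sum_mono2) auto
  also have "\<dots> \<le> block_const * M * real K powr (- s) * (\<Sum>j<n. r ^ j)"
    using dyadic[of n] by (simp add: sum_distrib_left)
  also have "\<dots> \<le> block_const * M * real K powr (- s) * (1 / (1 - r))"
  proof (rule mult_left_mono)
    show "(\<Sum>j<n. r ^ j) \<le> 1 / (1 - r)"
      using r sum_le_suminf[of "\<lambda>j. r ^ j" "{..<n}"] suminf_geometric[of r] summable_geometric[of r] by simp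
    show "0 \<le> block_const * M * real K powr (- s)"
      using s s_less_half M by (simp add: block_const_def)
  qed
  finally show ?thesis by (simp add: r_def)
qed

end

text \<open>The majorant has an arctangent as primitive and total integral at most
  \<open>B * pi / K\<close>. Hence each coefficient is at most \<open>B / K\<close>, and there are
  \<open>K\<close> of them.\<close>

lemma sum_head_le:
  fixes f :: "nat \<Rightarrow> complex"
  assumes f: "summable (\<lambda>k. norm (f k))" and K: "K \<ge> (1::nat)" and B: "B \<ge> 0"
    and bound: "\<And>x. x \<in> {-pi..pi} \<Longrightarrow> norm (fourier_nat f x) \<le> B / (1 + (real K * x)\<^sup>2)"
  shows "(\<Sum>k<K. norm (f k)) \<le> B"
proof -
  have K0: "real K > 0" using K by simp
  have "((\<lambda>x. B / (1 + (real K * x)\<^sup>2)) has_integral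
      (B / K * arctan (K * pi) - B / K * arctan (K * (- pi)))) {-pi..pi}"
  proof (rule fundamental_theorem_of_calculus)
    fix x
    show "((\<lambda>x. B / K * arctan (K * x)) has_vector_derivative B / (1 + (real K * x)\<^sup>2)) (at x within {-pi..pi})"
      unfolding has_real_derivative_iff_has_vector_derivative[symmetric]
      using K0 by (auto intro!: derivative_eq_intros simp: divide_simps)
  qed simp
  note int = this
  have "integral {-pi..pi} (\<lambda>x. norm (fourier_nat f x)) \<le> integral {-pi..pi} (\<lambda>x. B / (1 + (real K * x)\<^sup>2))"
  proof (rule integral_le)
    show "(\<lambda>x. norm (fourier_nat f x)) integrable_on {-pi..pi}"
      by (intro integrable_continuous_real continuous_intros continuous_on_fourier_nat f)
  qed (use int bound in auto)
  also have "\<dots> = 2 * (B / K) * arctan (K * pi)"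
    using integral_unique[OF int] by (simp add: arctan_minus)
  also have "\<dots> \<le> 2 * (B / K) * (pi / 2)"
    using arctan_ubound[of "K * pi"] B by (intro mult_left_mono) auto
  finally have int_le: "integral {-pi..pi} (\<lambda>x. norm (fourier_nat f x)) \<le> B * pi / K"
    by simp
  have "norm (f k) \<le> B / K" for k
  proof -
    have "2 * pi * norm (f k) \<le> B * pi / K"
      using fourier_nat_coefficient_bound[OF f, of k] int_le by linarith
    then have "2 * norm (f k) \<le> B / K" using mult_le_cancel_left_pos[OF pi_gt_zero, of "2 * norm (f k)" "B / K"] by (simp add: mult_ac)
    then show ?thesis using norm_ge_zero[of "f k"] by linarith
  qed
  then have "(\<Sum>k<K. norm (f k)) \<le> (\<Sum>k<K. B / K)" by (intro sum_mono)
  also have "\<dots> = B" using K0 by simp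
  finally show ?thesis .
qed

subsection \<open>The characteristic function of a regularly decaying distribution\<close>

text \<open>The cubic Taylor error is at most two thirds of \<open>\<bar>y\<bar>\<close> on this
  range. With \<open>y = t / 2\<close> it covers all \<open>\<bar>t\<bar> \<le> 4\<close>, hence
  \<open>[-pi, pi]\<close> with room to spare.\<close>

lemma sin_ge_third:
  fixes y :: real
  assumes "\<bar>y\<bar> \<le> 2"
  shows "\<bar>y\<bar> / 3 \<le> \<bar>sin y\<bar>"
proof -
  have "(\<Sum>m<3. sin_coeff m * y ^ m) = y"
    by (simp add: numeral_3_eq_3 sin_coeff_def)
  then have "\<bar>sin y - y\<bar> \<le> \<bar>y\<bar> ^ 3 / 6"
    using Maclaurin_sin_bound[of y 3] by (simp add: fact_numeral field_simps)
  moreover have "\<bar>y\<bar> ^ 3 \<le> 4 * \<bar>y\<bar>"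
  proof -
    have "\<bar>y\<bar>\<^sup>2 \<le> 2\<^sup>2" using assms by (intro power_mono) auto
    then have "\<bar>y\<bar> * \<bar>y\<bar>\<^sup>2 \<le> \<bar>y\<bar> * 4" by (intro mult_left_mono) auto
    then show ?thesis by (simp add: power3_eq_cube power2_eq_square mult_ac)
  qed
  ultimately show ?thesis by linarith
qed

lemma norm_one_minus_cis: "norm (1 - cis t) = 2 * \<bar>sin (t / 2)\<bar>"
  using dist_exp_i_1[of t] by (simp add: cis_conv_exp norm_minus_commute)

lemma norm_one_minus_cis_le: "norm (1 - cis t) \<le> \<bar>t\<bar>"
  using abs_sin_x_le_abs_x[of "t / 2"] by (simp add: norm_one_minus_cis)

lemma norm_one_minus_cis_ge: "\<bar>t\<bar> \<le> 4 \<Longrightarrow> \<bar>t\<bar> / 3 \<le> norm (1 - cis t)"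
  using sin_ge_third[of "t / 2"] by (simp add: norm_one_minus_cis)

lemma one_minus_cos: "1 - cos t = 2 * (sin (t / 2))\<^sup>2" for t :: real
  using cos_double_sin[of "t / 2"] by simp

lemma one_minus_cos_ge:
  fixes t :: real
  assumes "\<bar>t\<bar> \<le> 4"
  shows "t\<^sup>2 / 18 \<le> 1 - cos t"
proof -
  have "(\<bar>t / 2\<bar> / 3)\<^sup>2 \<le> \<bar>sin (t / 2)\<bar>\<^sup>2"
    using assms by (intro power_mono sin_ge_third) auto
  then show ?thesis by (simp add: one_minus_cos power_divide)
qed

lemma one_minus_cos_le: "1 - cos t \<le> \<bar>t\<bar>" for t :: real
  using complex_Re_le_cmod[of "1 - cis t"] norm_one_minus_cis_le[of t] by simp

section \<open>Geometric sums and summation by parts\<close>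

text \<open>Multiplication by \<open>1 - cis (- x)\<close> makes the sum telescope to a difference
  of norm at most \<open>2\<close>, while that factor has norm at least
  \<open>\<bar>x\<bar> / 3\<close>.\<close>

lemma norm_sum_cis_le:
  assumes x: "x \<noteq> 0" "\<bar>x\<bar> \<le> 4"
  shows "norm (\<Sum>k=m..<n. cis (- (real k * x))) \<le> 6 / \<bar>x\<bar>"
proof (cases "m \<le> n")
  case True
  have "(1 - cis (- x)) * (\<Sum>k=m..<n. cis (- (real k * x))) =
      (\<Sum>k=m..<n. - (cis (- (real (Suc k) * x)) - cis (- (real k * x))))"
    by (simp add: sum_distrib_left left_diff_distrib cis_mult distrib_right)
  also have "\<dots> = cis (- (real m * x)) - cis (- (real n * x))"
    unfolding sum_negf using sum_Suc_diff'[OF True, of "\<lambda>k. cis (- (real k * x))"] by simp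
  finally have "norm (1 - cis (- x)) * norm (\<Sum>k=m..<n. cis (- (real k * x))) =
      norm (cis (- (real m * x)) - cis (- (real n * x)))"
    by (metis norm_mult)
  also have "\<dots> \<le> 2"
    by (rule order_trans[OF norm_triangle_ineq4]) simp
  finally have "norm (1 - cis (- x)) * norm (\<Sum>k=m..<n. cis (- (real k * x))) \<le> 2" .
  moreover have "\<bar>x\<bar> / 3 * norm (\<Sum>k=m..<n. cis (- (real k * x))) \<le>
      norm (1 - cis (- x)) * norm (\<Sum>k=m..<n. cis (- (real k * x)))"
    using norm_one_minus_cis_ge[of "- x"] x by (intro mult_right_mono) auto
  ultimately have "\<bar>x\<bar> / 3 * norm (\<Sum>k=m..<n. cis (- (real k * x))) \<le> 2" by linarith
  then show ?thesis using x by (simp add: field_simps)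
qed (use x in auto)

lemma abel_summation:
  fixes d :: "nat \<Rightarrow> real" and z :: "nat \<Rightarrow> complex"
  assumes "m \<le> n"
  shows "(\<Sum>k=m..<n. d k * z k) =
    d n * (\<Sum>k=m..<n. z k) + (\<Sum>k=m..<n. (d k - d (Suc k)) * (\<Sum>j=m..<Suc k. z j))"
  using assms by (induction n rule: dec_induct) (simp_all add: algebra_simps)

text \<open>For nonnegative decreasing weights the boundary weight \<open>d n\<close> and the total
  variation \<open>d m - d n\<close> add up to \<open>d m\<close>, whatever \<open>n\<close>
  is.\<close>

lemma abel_bound:
  fixes d :: "nat \<Rightarrow> real" and z :: "nat \<Rightarrow> complex"
  assumes z: "\<And>n. norm (\<Sum>k=m..<n. z k) \<le> B"
    and dec: "\<And>k. m \<le> k \<Longrightarrow> d (Suc k) \<le> d k" and nonneg: "\<And>k. m \<le> k \<Longrightarrow> 0 \<le> d k"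
  shows "norm (\<Sum>k=m..<n. d k * z k) \<le> B * d m"
proof (cases "m \<le> n")
  case True
  have "norm (\<Sum>k=m..<n. d k * z k) \<le> norm (d n * (\<Sum>k=m..<n. z k)) +
      norm (\<Sum>k=m..<n. (d k - d (Suc k)) * (\<Sum>j=m..<Suc k. z j))"
    by (subst abel_summation[OF True]) (rule norm_triangle_ineq)
  also have "\<dots> \<le> d n * B + (\<Sum>k=m..<n. (d k - d (Suc k)) * B)"
  proof (intro add_mono order_trans[OF norm_sum] sum_mono)
    show "norm (d n * (\<Sum>k=m..<n. z k)) \<le> d n * B"
      using nonneg[OF True] z[of n] by (simp add: norm_mult mult_left_mono)
    fix k assume "k \<in> {m..<n}"
    then show "norm ((d k - d (Suc k)) * (\<Sum>j=m..<Suc k. z j)) \<le> (d k - d (Suc k)) * B"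
      unfolding norm_mult using dec[of k] z[of "Suc k"]
      by (intro mult_mono) (auto simp del: sum.op_ivl_Suc of_real_diff)
  qed
  also have "\<dots> = d n * B + (d m - d n) * B"
    using sum_Suc_diff'[OF True, of d]
    by (simp add: sum_distrib_right[symmetric] sum_subtractf)
  finally show ?thesis by (simp add: algebra_simps)
next
  case False
  \<comment> \<open>The sum is empty; the hypothesis at \<open>0\<close> serves only to give
    \<open>B \<ge> 0\<close>.\<close>
  then show ?thesis using order_trans[OF norm_ge_zero z[of 0]] nonneg[of m] by simp
qed

text \<open>By the mean value theorem each term is at most an increment of
  \<open>k powr (1 - \<alpha>) / (1 - \<alpha>)\<close>. The first increment is treated separately,
  as the derivative is singular at \<open>0\<close>.\<close>

lemma sum_powr_le:
  fixes \<alpha> :: real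
  assumes "0 < \<alpha>" "\<alpha> < 1"
  shows "(\<Sum>k=1..n. real k powr (- \<alpha>)) \<le> real n powr (1 - \<alpha>) / (1 - \<alpha>)"
proof (induction n)
  case (Suc n)
  have step: "(1 - \<alpha>) * real (Suc n) powr (- \<alpha>) \<le> real (Suc n) powr (1 - \<alpha>) - real n powr (1 - \<alpha>)"
  proof (cases "n = 0")
    case False
    have "\<exists>z. real n < z \<and> z < real (Suc n) \<and> real (Suc n) powr (1 - \<alpha>) - real n powr (1 - \<alpha>) =
        (real (Suc n) - real n) * ((1 - \<alpha>) * z powr (- \<alpha>))"
      by (rule MVT2) (use False assms in \<open>auto intro!: derivative_eq_intros\<close>)
    then obtain z where z: "real n < z" "z < real (Suc n)"
      "real (Suc n) powr (1 - \<alpha>) - real n powr (1 - \<alpha>) = (1 - \<alpha>) * z powr (- \<alpha>)"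
      by auto
    have "real (Suc n) powr (- \<alpha>) \<le> z powr (- \<alpha>)"
      using z assms False by (intro powr_mono2') auto
    then show ?thesis using z(3) assms by (simp add: mult_left_mono)
  qed (use assms in auto)
  then have "real (Suc n) powr (- \<alpha>) \<le> (real (Suc n) powr (1 - \<alpha>) - real n powr (1 - \<alpha>)) / (1 - \<alpha>)"
    using assms by (simp add: field_simps)
  with Suc show ?case by (simp add: diff_divide_distrib)
qed simp

section \<open>The transform and its derivative for a heavy-tailed distribution\<close>

text \<open>Of the leading part \<open>d\<close> of \<open>k * a k\<close> only monotonicity and
  two-sided power bounds matter, not its form as a sum of powers. The conditions start at index
  \<open>1\<close>: in the application \<open>d 0 = 0\<close>, because \<open>0 powr\<close>
  anything is \<open>0\<close>, so \<open>d\<close> increases from \<open>0\<close> to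
  \<open>1\<close>.\<close>

locale heavy_tail =
  fixes a d :: "nat \<Rightarrow> real" and \<alpha> c C :: real
  assumes a_nonneg: "\<And>k. a k \<ge> 0" and a_sums: "a sums 1"
    and alpha: "0 < \<alpha>" "\<alpha> < 1" and c: "c > 0"
    and d_lower: "\<And>k. k \<ge> 1 \<Longrightarrow> c * real k powr (- \<alpha>) \<le> d k"
    and d_upper: "\<And>k. k \<ge> 1 \<Longrightarrow> d k \<le> C * real k powr (- \<alpha>)"
    and d_dec: "\<And>k. k \<ge> 1 \<Longrightarrow> d (Suc k) \<le> d k"
    and remainder: "summable (\<lambda>k. \<bar>real k * a k - d k\<bar>)"
begin

definition \<phi> :: "real \<Rightarrow> complex" where "\<phi> = fourier_nat (\<lambda>k. of_real (a k))"

definition q :: "nat \<Rightarrow> real" where "q k = real k * a k - d k"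

definition Q :: real where "Q = (\<Sum>k. \<bar>q k\<bar>)"

text \<open>The formal termwise derivative. Its series is not absolutely convergent, since
  \<open>k * a k\<close> behaves like \<open>k powr (- \<alpha>)\<close>; convergence is shown in
  \<open>phi'_sums\<close> for \<open>0 < \<bar>x\<bar> \<le> 4\<close>.\<close>

definition \<phi>' :: "real \<Rightarrow> complex" where
  "\<phi>' x = (\<Sum>k. of_real (real k * a k) * (- \<i> * cis (- (real k * x))))"

lemma d_nonneg: "k \<ge> 1 \<Longrightarrow> d k \<ge> 0"
  using d_lower[of k] c by (meson less_imp_le mult_nonneg_nonneg order_trans powr_ge_zero)

lemma C_pos: "C > 0"
  using d_lower[of 1] d_upper[of 1] c by simp

lemma summable_a: "summable (\<lambda>k. norm (complex_of_real (a k)))"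
  using a_sums a_nonneg by (simp add: sums_iff)

lemma summable_q: "summable (\<lambda>k. \<bar>q k\<bar>)"
  using remainder by (simp add: q_def)

lemma Q_nonneg: "Q \<ge> 0"
  unfolding Q_def by (rule suminf_nonneg[OF summable_q]) simp

lemma sum_q_le: "finite A \<Longrightarrow> (\<Sum>k\<in>A. \<bar>q k\<bar>) \<le> Q"
  unfolding Q_def by (rule sum_le_suminf[OF summable_q]) auto

lemma sum_q_tail_le: "(\<Sum>k=m..<n. \<bar>q k\<bar>) \<le> (\<Sum>k. \<bar>q (k + m)\<bar>)"
proof (cases "m \<le> n")
  case True
  have "(\<Sum>k=m..<n. \<bar>q k\<bar>) = (\<Sum>k<n - m. \<bar>q (k + m)\<bar>)"
    using True sum.shift_bounds_nat_ivl[of "\<lambda>k. \<bar>q k\<bar>" 0 m "n - m"] by (simp add: lessThan_atLeast0)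
  also have "\<dots> \<le> (\<Sum>k. \<bar>q (k + m)\<bar>)"
    by (rule sum_le_suminf) (auto intro: summable_ignore_initial_segment[OF summable_q])
  finally show ?thesis .
qed (auto intro!: suminf_nonneg intro: summable_ignore_initial_segment[OF summable_q])

lemma continuous_phi: "continuous_on A \<phi>"
  unfolding \<phi>_def by (rule continuous_on_fourier_nat[OF summable_a])

lemma phi_zero: "\<phi> 0 = 1"
  using a_sums sums_of_real[of a 1, where ?'a = complex]
  by (simp add: \<phi>_def fourier_nat_def sums_iff)

text \<open>Bounds the tail of the derivative series from index \<open>m\<close> on at distance
  \<open>\<delta>\<close> from the origin; being decreasing in \<open>\<delta>\<close>, it yields
  uniform convergence away from \<open>0\<close>.\<close>

definition rest :: "real \<Rightarrow> nat \<Rightarrow> real" where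
  "rest \<delta> m = 6 / \<delta> * d m + (\<Sum>k. \<bar>q (k + m)\<bar>)"

lemma rest_tendsto: "rest \<delta> \<longlonglongrightarrow> 0"
proof -
  have "(\<lambda>m. real m powr (- \<alpha>)) \<longlonglongrightarrow> 0"
    using alpha by (intro tendsto_neg_powr filterlim_real_sequentially) auto
  then have upper: "(\<lambda>m. C * real m powr (- \<alpha>)) \<longlonglongrightarrow> 0"
    by (rule tendsto_mult_right_zero)
  have "d \<longlonglongrightarrow> 0"
  proof (rule tendsto_sandwich[OF _ _ tendsto_const upper])
    show "\<forall>\<^sub>F k in sequentially. 0 \<le> d k"
      by (rule eventually_sequentiallyI[of 1]) (rule d_nonneg)
    show "\<forall>\<^sub>F k in sequentially. d k \<le> C * real k powr (- \<alpha>)"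
      by (rule eventually_sequentiallyI[of 1]) (rule d_upper)
  qed
  then have "(\<lambda>m. 6 / \<delta> * d m) \<longlonglongrightarrow> 0" by (rule tendsto_mult_right_zero)
  moreover have "(\<lambda>m. \<Sum>k. \<bar>q (k + m)\<bar>) \<longlonglongrightarrow> 0"
  proof (rule LIMSEQ_I)
    fix r :: real assume "0 < r"
    from suminf_exist_split[OF this summable_q]
    show "\<exists>N. \<forall>n\<ge>N. norm ((\<Sum>k. \<bar>q (k + n)\<bar>) - 0) < r" by simp
  qed
  ultimately show ?thesis unfolding rest_def by (auto intro: tendsto_add_zero)
qed

text \<open>Split \<open>k * a k\<close> into \<open>d k + q k\<close>: the monotone part is handled
  by Abel summation against the geometric sums, the remainder in absolute value.\<close>

lemma derivative_terms_bound:
  assumes x: "x \<noteq> 0" "\<bar>x\<bar> \<le> 4" and m: "m \<ge> 1"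
  shows "norm (\<Sum>k=m..<n. of_real (real k * a k) * (- \<i> * cis (- (real k * x)))) \<le> rest \<bar>x\<bar> m"
proof -
  have "(\<Sum>k=m..<n. of_real (real k * a k) * (- \<i> * cis (- (real k * x)))) =
      - \<i> * (\<Sum>k=m..<n. d k * cis (- (real k * x))) + - \<i> * (\<Sum>k=m..<n. q k * cis (- (real k * x)))"
    by (simp add: q_def sum_distrib_left sum.distrib[symmetric] algebra_simps)
  also have "norm \<dots> \<le> norm (\<Sum>k=m..<n. d k * cis (- (real k * x))) + norm (\<Sum>k=m..<n. q k * cis (- (real k * x)))"
    by (rule order_trans[OF norm_triangle_ineq]) (simp add: norm_mult)
  also have "\<dots> \<le> 6 / \<bar>x\<bar> * d m + (\<Sum>k. \<bar>q (k + m)\<bar>)"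
  proof (rule add_mono)
    show "norm (\<Sum>k=m..<n. d k * cis (- (real k * x))) \<le> 6 / \<bar>x\<bar> * d m"
      by (rule abel_bound) (use norm_sum_cis_le[OF x] d_dec d_nonneg m in auto)
    have "norm (\<Sum>k=m..<n. q k * cis (- (real k * x))) \<le> (\<Sum>k=m..<n. \<bar>q k\<bar>)"
      by (rule order_trans[OF norm_sum]) (simp add: norm_mult)
    also note sum_q_tail_le
    finally show "norm (\<Sum>k=m..<n. q k * cis (- (real k * x))) \<le> (\<Sum>k. \<bar>q (k + m)\<bar>)" .
  qed
  finally show ?thesis by (simp add: rest_def)
qed

lemma phi'_sums:
  assumes x: "x \<noteq> 0" "\<bar>x\<bar> \<le> 4"
  shows "(\<lambda>k. of_real (real k * a k) * (- \<i> * cis (- (real k * x)))) sums \<phi>' x"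
proof -
  have "summable (\<lambda>k. of_real (real k * a k) * (- \<i> * cis (- (real k * x))))"
    by (rule summable_Cauchy'[OF _ rest_tendsto[of "\<bar>x\<bar>"]])
       (intro eventually_sequentiallyI[of 1] allI impI derivative_terms_bound x)
  then show ?thesis unfolding \<phi>'_def by (rule summable_sums)
qed

lemma phi'_remainder:
  assumes x: "x \<noteq> 0" "\<bar>x\<bar> \<le> 4" and m: "m \<ge> 1"
  shows "norm ((\<Sum>k<m. of_real (real k * a k) * (- \<i> * cis (- (real k * x)))) - \<phi>' x) \<le> rest \<bar>x\<bar> m"
proof -
  let ?f = "\<lambda>k. of_real (real k * a k) * (- \<i> * cis (- (real k * x)))"
  have "(\<lambda>n. sum ?f {..<n} - sum ?f {..<m}) \<longlonglongrightarrow> \<phi>' x - sum ?f {..<m}"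
    using phi'_sums[OF x] unfolding sums_def by (intro tendsto_intros)
  moreover have "\<forall>\<^sub>F n in sequentially. norm (sum ?f {..<n} - sum ?f {..<m}) \<le> rest \<bar>x\<bar> m"
  proof (rule eventually_sequentiallyI[of m])
    fix n assume "m \<le> n"
    then have "sum ?f {..<n} - sum ?f {..<m} = sum ?f {m..<n}"
      using sum_diff_nat_ivl[of 0 m n ?f] by (simp add: lessThan_atLeast0)
    then show "norm (sum ?f {..<n} - sum ?f {..<m}) \<le> rest \<bar>x\<bar> m"
      using derivative_terms_bound[OF x m] by simp
  qed
  ultimately have "norm (\<phi>' x - sum ?f {..<m}) \<le> rest \<bar>x\<bar> m"
    by (intro Lim_norm_ubound[of sequentially]) auto
  then show ?thesis by (simp add: norm_minus_commute)
qed

lemma rest_antimono: "0 < \<delta> \<Longrightarrow> \<delta> \<le> \<eta> \<Longrightarrow> m \<ge> 1 \<Longrightarrow> rest \<eta> m \<le> rest \<delta> m"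
  unfolding rest_def using d_nonneg[of m] by (intro add_mono mult_right_mono divide_left_mono) auto

text \<open>Termwise differentiation on a small ball about \<open>x0\<close>, where
  \<open>rest (\<bar>x0\<bar> / 2)\<close> bounds the tails of the derivative series
  uniformly.\<close>

lemma phi_has_vector_derivative:
  assumes x0: "x0 \<noteq> 0" "\<bar>x0\<bar> < 4"
  shows "(\<phi> has_vector_derivative \<phi>' x0) (at x0)"
proof -
  \<comment> \<open>The first entry keeps the ball at distance \<open>\<bar>x0\<bar> / 2\<close>
    from the singularity at \<open>0\<close>, the second keeps it inside radius
    \<open>4\<close>.\<close>
  define \<delta> where "\<delta> = min (\<bar>x0\<bar> / 2) (4 - \<bar>x0\<bar>)"
  define S where "S = ball x0 \<delta>"
  have \<delta>: "\<delta> > 0" using x0 by (simp add: \<delta>_def)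
  have S: "x \<noteq> 0" "\<bar>x\<bar> \<le> 4" "\<bar>x0\<bar> / 2 \<le> \<bar>x\<bar>" if "x \<in> S" for x
  proof -
    have "\<bar>x0 - x\<bar> < \<bar>x0\<bar> / 2" "\<bar>x0 - x\<bar> < 4 - \<bar>x0\<bar>"
      using that by (auto simp: S_def \<delta>_def dist_real_def)
    then show "x \<noteq> 0" "\<bar>x\<bar> \<le> 4" "\<bar>x0\<bar> / 2 \<le> \<bar>x\<bar>" by linarith+
  qed
  define f where "f k x = of_real (a k) * cis (- (real k * x))" for k x
  define f' where "f' k x = of_real (real k * a k) * (- \<i> * cis (- (real k * x)))" for k x
  have "\<exists>g. \<forall>x\<in>S. (\<lambda>n. f n x) sums g x \<and> (g has_derivative (\<lambda>h. h *\<^sub>R \<phi>' x)) (at x within S)"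
  proof (rule has_derivative_series)
    show "convex S" by (simp add: S_def)
    show "(f n has_derivative (\<lambda>h. h *\<^sub>R f' n x)) (at x within S)" for n x
    proof -
      have "((\<lambda>z. of_real (a n) * exp (- \<i> * of_nat n * z)) has_field_derivative
          of_real (a n) * (exp (- \<i> * of_nat n * of_real x) * (- \<i> * of_nat n))) (at (of_real x))"
        by (auto intro!: derivative_eq_intros)
      from has_vector_derivative_real_field[OF this, of S]
      have "(f n has_vector_derivative f' n x) (at x within S)"
        by (simp add: f_def[abs_def] f'_def cis_conv_exp mult_ac)
      then show ?thesis by (simp add: has_vector_derivative_def)
    qed
    show "\<forall>\<^sub>F n in sequentially. \<forall>x\<in>S. \<forall>h. norm ((\<Sum>i<n. h *\<^sub>R f' i x) - h *\<^sub>R \<phi>' x) \<le> e * norm h"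
      if "e > 0" for e
    proof -
      have "\<forall>\<^sub>F n in sequentially. rest (\<bar>x0\<bar> / 2) n < e"
        using rest_tendsto that by (rule order_tendstoD)
      moreover have "\<forall>\<^sub>F n in sequentially. n \<ge> (1::nat)" by (rule eventually_ge_at_top)
      ultimately show ?thesis
      proof eventually_elim
        case (elim n)
        have "norm ((\<Sum>i<n. h *\<^sub>R f' i x) - h *\<^sub>R \<phi>' x) \<le> e * norm h" if "x \<in> S" for x h
        proof -
          have "norm ((\<Sum>i<n. f' i x) - \<phi>' x) \<le> rest \<bar>x\<bar> n"
            unfolding f'_def by (rule phi'_remainder) (use S that elim in auto)
          also have "\<dots> \<le> rest (\<bar>x0\<bar> / 2) n"
            by (rule rest_antimono) (use S that elim x0 in auto)
          also have "\<dots> \<le> e" using elim by simp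
          finally have "norm h * norm ((\<Sum>i<n. f' i x) - \<phi>' x) \<le> norm h * e"
            by (rule mult_left_mono) simp
          then show ?thesis
            by (simp add: scaleR_sum_right[symmetric] scaleR_diff_right[symmetric] mult.commute)
        qed
        then show ?case by blast
      qed
    qed
    show "x0 \<in> S" using \<delta> by (simp add: S_def)
    show "(\<lambda>n. f n x0) sums \<phi> x0"
      unfolding f_def \<phi>_def fourier_nat_def by (intro summable_sums summable_fourier_nat summable_a)
  qed
  then obtain g where g: "\<And>x. x \<in> S \<Longrightarrow> (\<lambda>n. f n x) sums g x"
    "\<And>x. x \<in> S \<Longrightarrow> (g has_derivative (\<lambda>h. h *\<^sub>R \<phi>' x)) (at x within S)" by blast
  \<comment> \<open>The differentiation theorem only provides some limit function, which uniqueness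
    of sums identifies with \<open>\<phi>\<close> on the ball.\<close>
  have eq: "g x = \<phi> x" if "x \<in> S" for x
    using g(1)[OF that] by (simp add: f_def \<phi>_def fourier_nat_def sums_iff)
  have x0S: "x0 \<in> S" "open S" using \<delta> by (auto simp: S_def)
  then have "(g has_derivative (\<lambda>h. h *\<^sub>R \<phi>' x0)) (at x0)"
    using g(2)[OF x0S(1)] at_within_open by metis
  then have "(\<phi> has_derivative (\<lambda>h. h *\<^sub>R \<phi>' x0)) (at x0)"
    by (rule has_derivative_transform_within_open[OF _ x0S(2,1) eq])
  then show ?thesis by (simp add: has_vector_derivative_def)
qed

section \<open>Size of the derivative near the origin\<close>

text \<open>The terms come from the head, from Abel summation of the tail, and from the remainder
  \<open>q\<close>: it enters twice with weight \<open>Q\<close>, each time absorbed at the cost of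
  a factor \<open>4\<close>.\<close>

definition C1 :: real where "C1 = C / (1 - \<alpha>) + 6 * C + 8 * Q"

lemma C1_pos: "C1 > 0"
proof -
  have "C / (1 - \<alpha>) \<ge> 0" using C_pos alpha by simp
  then show ?thesis unfolding C1_def using C_pos Q_nonneg by linarith
qed

text \<open>The terms with \<open>k \<le> 1 / \<bar>x\<bar>\<close> are estimated absolutely, the remaining ones by Abel summation.\<close>

lemma phi'_bound:
  assumes x: "x \<noteq> 0" "\<bar>x\<bar> \<le> 4"
  shows "norm (\<phi>' x) \<le> C1 * \<bar>x\<bar> powr (\<alpha> - 1)"
proof -
  define M where "M = nat \<lfloor>1 / \<bar>x\<bar>\<rfloor>"
  have M: "real M \<le> 1 / \<bar>x\<bar>" "1 / \<bar>x\<bar> \<le> real (Suc M)"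
    unfolding M_def by (auto simp: le_of_int_ceiling) linarith+
  let ?f = "\<lambda>k. of_real (real k * a k) * (- \<i> * cis (- (real k * x)))"
  have powr_eq: "(1 / \<bar>x\<bar>) powr (1 - \<alpha>) = \<bar>x\<bar> powr (\<alpha> - 1)" "(1 / \<bar>x\<bar>) powr (- \<alpha>) = \<bar>x\<bar> powr \<alpha>"
    using x by (simp_all add: powr_divide powr_minus_divide powr_diff)
  have "norm (sum ?f {..<Suc M}) \<le> (\<Sum>k<Suc M. real k * a k)"
    by (rule order_trans[OF norm_sum]) (use a_nonneg in \<open>simp add: norm_mult\<close>)
  \<comment> \<open>Index \<open>0\<close> contributes nothing, and it has to go since the bounds on
    \<open>d\<close> start at \<open>1\<close>.\<close>
  also have "\<dots> = (\<Sum>k=1..M. d k + q k)"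
    unfolding q_def by (rule sum.mono_neutral_cong_right) auto
  also have "\<dots> \<le> (\<Sum>k=1..M. C * real k powr (- \<alpha>) + \<bar>q k\<bar>)"
    by (intro sum_mono add_mono d_upper) auto
  also have "\<dots> = C * (\<Sum>k=1..M. real k powr (- \<alpha>)) + (\<Sum>k=1..M. \<bar>q k\<bar>)"
    by (simp add: sum.distrib sum_distrib_left)
  also have "\<dots> \<le> C * (real M powr (1 - \<alpha>) / (1 - \<alpha>)) + Q"
    using C_pos by (intro add_mono mult_left_mono sum_powr_le alpha sum_q_le) auto
  also have "\<dots> \<le> C * (\<bar>x\<bar> powr (\<alpha> - 1) / (1 - \<alpha>)) + Q"
    using C_pos alpha M unfolding powr_eq[symmetric]
    by (intro add_mono mult_left_mono divide_right_mono powr_mono2) auto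
  finally have head: "norm (sum ?f {..<Suc M}) \<le> C / (1 - \<alpha>) * \<bar>x\<bar> powr (\<alpha> - 1) + Q" by simp
  have "norm (sum ?f {..<Suc M} - \<phi>' x) \<le> rest \<bar>x\<bar> (Suc M)"
    by (rule phi'_remainder[OF x]) simp
  also have "\<dots> \<le> 6 / \<bar>x\<bar> * (C * \<bar>x\<bar> powr \<alpha>) + Q"
    unfolding rest_def
  proof (intro add_mono mult_left_mono)
    have "d (Suc M) \<le> C * real (Suc M) powr (- \<alpha>)" by (rule d_upper) simp
    also have "\<dots> \<le> C * (1 / \<bar>x\<bar>) powr (- \<alpha>)"
      using M C_pos alpha x by (intro mult_left_mono powr_mono2') auto
    finally show "d (Suc M) \<le> C * \<bar>x\<bar> powr \<alpha>" by (simp only: powr_eq)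
    show "(\<Sum>k. \<bar>q (k + Suc M)\<bar>) \<le> Q"
      unfolding Q_def using suminf_minus_initial_segment[OF summable_q, of "Suc M"]
        sum_nonneg[of "{..<Suc M}" "\<lambda>k. \<bar>q k\<bar>"] by linarith
  qed auto
  also have "6 / \<bar>x\<bar> * (C * \<bar>x\<bar> powr \<alpha>) = 6 * C * \<bar>x\<bar> powr (\<alpha> - 1)"
    using x by (simp add: powr_diff)
  finally have tail: "norm (sum ?f {..<Suc M} - \<phi>' x) \<le> 6 * C * \<bar>x\<bar> powr (\<alpha> - 1) + Q" .
  \<comment> \<open>Turns the constant \<open>Q\<close> into a multiple of the singular power, using
    \<open>\<bar>x\<bar> \<le> 4\<close>.\<close>
  have "1 \<le> 4 * \<bar>x\<bar> powr (\<alpha> - 1)"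
  proof -
    have "4 powr (-1) \<le> (4::real) powr (\<alpha> - 1)" using alpha by (intro powr_mono) auto
    also have "\<dots> \<le> \<bar>x\<bar> powr (\<alpha> - 1)" using x alpha by (intro powr_mono2') auto
    finally show ?thesis by (simp add: powr_minus)
  qed
  then have "Q * 1 \<le> Q * (4 * \<bar>x\<bar> powr (\<alpha> - 1))"
    using Q_nonneg by (rule mult_left_mono)
  moreover have "norm (\<phi>' x) \<le> norm (sum ?f {..<Suc M}) + norm (sum ?f {..<Suc M} - \<phi>' x)"
    using norm_triangle_ineq2[of "\<phi>' x" "sum ?f {..<Suc M}"] by (simp only: norm_minus_commute[of "\<phi>' x"])
  ultimately have "norm (\<phi>' x) \<le> C / (1 - \<alpha>) * \<bar>x\<bar> powr (\<alpha> - 1) + 6 * C * \<bar>x\<bar> powr (\<alpha> - 1) + 2 * (Q * (4 * \<bar>x\<bar> powr (\<alpha> - 1)))"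
    using head tail by linarith
  then show ?thesis by (simp add: C1_def algebra_simps)
qed

lemma singular_derivative_phi: "singular_derivative \<phi> \<phi>' C1 \<alpha> 4"
  by standard (use continuous_phi phi_has_vector_derivative phi'_bound alpha C1_pos in auto)

lemma phi_holder: "\<bar>x\<bar> < 4 \<Longrightarrow> norm (1 - \<phi> x) \<le> C1 / \<alpha> * \<bar>x\<bar> powr \<alpha>"
proof -
  interpret singular_derivative \<phi> \<phi>' C1 \<alpha> 4 by (rule singular_derivative_phi)
  assume "\<bar>x\<bar> < 4"
  from holder_at_zero[OF this] show ?thesis by (simp add: phi_zero norm_minus_commute)
qed

section \<open>Lower bound for the real part of \<open>1 - \<phi>\<close>\<close>

lemma one_minus_Re_phi_sums: "(\<lambda>k. a k * (1 - cos (real k * x))) sums (1 - Re (\<phi> x))"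
proof -
  have "(\<lambda>k. of_real (a k) * cis (- (real k * x))) sums \<phi> x"
    unfolding \<phi>_def fourier_nat_def by (intro summable_sums summable_fourier_nat summable_a)
  then have "(\<lambda>k. a k * cos (real k * x)) sums Re (\<phi> x)"
    using sums_Re by fastforce
  from sums_diff[OF a_sums this] show ?thesis by (simp add: algebra_simps)
qed

text \<open>All terms of the cosine series are nonnegative, so only those with
  \<open>k \<le> 1 / \<bar>x\<bar>\<close> are kept. There \<open>1 - cos (k * x)\<close> is at
  least \<open>(k * x)\<^sup>2 / 18\<close> and \<open>d k\<close> at least
  \<open>c * \<bar>x\<bar> powr \<alpha>\<close>, and the sum of these \<open>k\<close> is at least
  \<open>1 / (4 * x\<^sup>2)\<close>, which gives \<open>72 = 18 * 4\<close>.\<close>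

lemma Re_phi_lower_bound_aux:
  assumes x: "x \<noteq> 0" "\<bar>x\<bar> \<le> 1"
  shows "c / 72 * \<bar>x\<bar> powr \<alpha> - Q * \<bar>x\<bar> \<le> 1 - Re (\<phi> x)"
proof -
  define M where "M = nat \<lfloor>1 / \<bar>x\<bar>\<rfloor>"
  have "1 / \<bar>x\<bar> \<ge> 1" using x by simp
  then have M: "real M \<le> 1 / \<bar>x\<bar>" "1 / \<bar>x\<bar> < real M + 1"
    unfolding M_def by (simp_all add: of_nat_nat)
  from \<open>1 / \<bar>x\<bar> \<ge> 1\<close> have M1: "M \<ge> 1" unfolding M_def by (simp add: le_nat_floor)
  have term_ge: "a k * (1 - cos (real k * x)) \<ge> c * \<bar>x\<bar> powr \<alpha> * x\<^sup>2 / 18 * real k - \<bar>q k\<bar> * \<bar>x\<bar>"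
    if k: "k \<in> {1..M}" for k
  proof -
    have k1: "real k \<ge> 1" using k by simp
    have kM: "real k \<le> 1 / \<bar>x\<bar>" using k M by (simp add: order_trans[OF _ M(1)])
    then have kx: "\<bar>real k * x\<bar> \<le> 1" using x by (simp add: abs_mult field_simps)
    have a_eq: "a k = d k / k + q k / k" using k1 by (simp add: q_def field_simps)
    have "c * \<bar>x\<bar> powr \<alpha> \<le> c * real k powr (- \<alpha>)"
    proof (rule mult_left_mono)
      have "\<bar>x\<bar> powr \<alpha> = (1 / \<bar>x\<bar>) powr (- \<alpha>)" using x by (simp add: powr_divide powr_minus_divide)
      also have "\<dots> \<le> real k powr (- \<alpha>)" using kM k1 alpha by (intro powr_mono2') auto
      finally show "\<bar>x\<bar> powr \<alpha> \<le> real k powr (- \<alpha>)" .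
    qed (use c in simp)
    also have "\<dots> \<le> d k" by (rule d_lower) (use k in auto)
    finally have dk: "c * \<bar>x\<bar> powr \<alpha> \<le> d k" .
    have "c * \<bar>x\<bar> powr \<alpha> / k * ((real k * x)\<^sup>2 / 18) \<le> d k / k * (1 - cos (real k * x))"
      using dk kx c k1 d_nonneg[of k] k
      by (intro mult_mono divide_right_mono one_minus_cos_ge divide_nonneg_nonneg) auto
    moreover have "c * \<bar>x\<bar> powr \<alpha> / k * ((real k * x)\<^sup>2 / 18) = c * \<bar>x\<bar> powr \<alpha> * x\<^sup>2 / 18 * real k"
      using k1 by (simp add: power2_eq_square)
    moreover have "- (\<bar>q k\<bar> * \<bar>x\<bar>) \<le> q k / k * (1 - cos (real k * x))"
    proof -
      have "\<bar>q k / k * (1 - cos (real k * x))\<bar> \<le> \<bar>q k\<bar> / k * \<bar>real k * x\<bar>"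
        unfolding abs_mult using one_minus_cos_le[of "real k * x"]
        by (intro mult_mono) (auto simp: abs_mult)
      also have "\<dots> = \<bar>q k\<bar> * \<bar>x\<bar>" using k1 by (simp add: abs_mult)
      finally show ?thesis by linarith
    qed
    ultimately show ?thesis unfolding a_eq by (simp add: distrib_right)
  qed
  have gauss: "(\<Sum>k=1..M. real k) = real M * (real M + 1) / 2"
    by (induction M) (auto simp: field_simps)
  have "1 / (2 * \<bar>x\<bar>) * (1 / \<bar>x\<bar>) \<le> real M * (real M + 1)"
  proof (intro mult_mono)
    have "1 \<le> real M" using M1 by simp
    then have "1 / \<bar>x\<bar> \<le> 2 * real M" using M(2) by linarith
    then show "1 / (2 * \<bar>x\<bar>) \<le> real M" using x by (simp add: field_simps)
  qed (use M(2) in auto)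
  then have "c * \<bar>x\<bar> powr \<alpha> * x\<^sup>2 / 18 * (1 / (2 * \<bar>x\<bar>) * (1 / \<bar>x\<bar>) / 2) \<le> c * \<bar>x\<bar> powr \<alpha> * x\<^sup>2 / 18 * (real M * (real M + 1) / 2)"
    using c by (intro mult_left_mono) auto
  moreover have "c * \<bar>x\<bar> powr \<alpha> * x\<^sup>2 / 18 * (1 / (2 * \<bar>x\<bar>) * (1 / \<bar>x\<bar>) / 2) = c / 72 * \<bar>x\<bar> powr \<alpha>"
    using x by (simp add: power2_eq_square field_simps)
  ultimately have "c / 72 * \<bar>x\<bar> powr \<alpha> - Q * \<bar>x\<bar> \<le>
      c * \<bar>x\<bar> powr \<alpha> * x\<^sup>2 / 18 * (\<Sum>k=1..M. real k) - (\<Sum>k=1..M. \<bar>q k\<bar>) * \<bar>x\<bar>"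
    unfolding gauss
    using mult_right_mono[OF sum_q_le[OF finite_atLeastAtMost[of 1 M]] abs_ge_zero[of x]] by linarith
  also have "\<dots> = (\<Sum>k=1..M. c * \<bar>x\<bar> powr \<alpha> * x\<^sup>2 / 18 * real k - \<bar>q k\<bar> * \<bar>x\<bar>)"
    by (simp only: sum_subtractf sum_distrib_left sum_distrib_right)
  also have "\<dots> \<le> (\<Sum>k=1..M. a k * (1 - cos (real k * x)))"
    by (intro sum_mono term_ge)
  also have "\<dots> \<le> (\<Sum>k. a k * (1 - cos (real k * x)))"
    using one_minus_Re_phi_sums[of x] a_nonneg
    by (intro sum_le_suminf) (auto simp: sums_iff)
  also have "\<dots> = 1 - Re (\<phi> x)"
    using one_minus_Re_phi_sums[of x] by (simp add: sums_iff)
  finally show ?thesis .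
qed

lemma Re_phi_lower_bound:
  obtains \<epsilon> where "0 < \<epsilon>" "\<epsilon> < 1" "\<And>x. \<bar>x\<bar> \<le> \<epsilon> \<Longrightarrow> \<epsilon> * \<bar>x\<bar> powr \<alpha> \<le> 1 - Re (\<phi> x)"
proof -
  \<comment> \<open>Below the threshold \<open>r powr (1 / (1 - \<alpha>))\<close> the error
    \<open>Q * \<bar>x\<bar>\<close> is at most half the main term, leaving the coefficient
    \<open>c / 144\<close>. The \<open>Q + 1\<close> avoids a division by zero.\<close>
  define r where "r = c / (144 * (Q + 1))"
  have r: "r > 0" using c Q_nonneg by (simp add: r_def)
  define \<epsilon> where "\<epsilon> = min (1 / 2) (min (c / 144) (r powr (1 / (1 - \<alpha>))))"
  have eps: "0 < \<epsilon>" "\<epsilon> < 1" "\<epsilon> \<le> c / 144" "\<epsilon> \<le> r powr (1 / (1 - \<alpha>))"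
    using c r by (auto simp: \<epsilon>_def)
  show thesis
  proof (rule that[OF eps(1,2)])
    fix x assume x: "\<bar>x\<bar> \<le> \<epsilon>"
    show "\<epsilon> * \<bar>x\<bar> powr \<alpha> \<le> 1 - Re (\<phi> x)"
    proof (cases "x = 0")
      case True
      then show ?thesis by (simp add: phi_zero)
    next
      case False
      have "\<bar>x\<bar> powr (1 - \<alpha>) \<le> (r powr (1 / (1 - \<alpha>))) powr (1 - \<alpha>)"
        using x eps alpha by (intro powr_mono2) auto
      also have "\<dots> = r" using alpha r by (simp add: powr_powr)
      finally have "\<bar>x\<bar> powr (1 - \<alpha>) \<le> r" .
      then have "(Q + 1) * \<bar>x\<bar> powr (1 - \<alpha>) \<le> c / 144"
        using Q_nonneg mult_left_mono[of "\<bar>x\<bar> powr (1 - \<alpha>)" r "Q + 1"]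
        by (simp add: r_def field_simps)
      then have "Q * \<bar>x\<bar> powr (1 - \<alpha>) \<le> c / 144"
        using powr_ge_zero[of "\<bar>x\<bar>" "1 - \<alpha>"] unfolding distrib_right mult_1 by linarith
      then have "Q * \<bar>x\<bar> powr (1 - \<alpha>) * \<bar>x\<bar> powr \<alpha> \<le> c / 144 * \<bar>x\<bar> powr \<alpha>"
        by (intro mult_right_mono) auto
      moreover have "\<bar>x\<bar> powr (1 - \<alpha>) * \<bar>x\<bar> powr \<alpha> = \<bar>x\<bar>"
        using False by (simp add: powr_add[symmetric])
      ultimately have "Q * \<bar>x\<bar> \<le> c / 144 * \<bar>x\<bar> powr \<alpha>" by (simp add: mult.assoc)
      moreover have "\<epsilon> * \<bar>x\<bar> powr \<alpha> \<le> c / 144 * \<bar>x\<bar> powr \<alpha>"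
        using eps by (intro mult_right_mono) auto
      ultimately show ?thesis
        using Re_phi_lower_bound_aux[OF False] x eps by simp
    qed
  qed
qed

text \<open>Wherever \<open>a\<close> vanishes, \<open>\<bar>q k\<bar> = d k \<ge> c / k\<close>; this happening in every pair of
  consecutive indices would make the harmonic series converge.\<close>

lemma consecutive_support: "\<exists>k. a k > 0 \<and> a (Suc k) > 0"
proof (rule ccontr)
  assume no: "\<not> ?thesis"
  have lower: "c / real (Suc k) \<le> \<bar>q k\<bar> + \<bar>q (Suc k)\<bar>" if k: "k \<ge> 1" for k
  proof -
    have vanish: "c / real (Suc k) \<le> \<bar>q j\<bar>" if j: "j = k \<or> j = Suc k" "a j = 0" for j
    proof -
      have j1: "1 \<le> real j" "real j \<le> real (Suc k)" using j k by auto
      have "c / real (Suc k) \<le> c * real j powr (- 1)"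
        using j1 c by (simp add: powr_minus_divide frac_le)
      also have "\<dots> \<le> c * real j powr (- \<alpha>)"
        using j1 c alpha by (intro mult_left_mono powr_mono) auto
      also have "\<dots> \<le> d j" using j1 by (intro d_lower) simp
      finally show ?thesis using j by (simp add: q_def)
    qed
    have "a k = 0 \<or> a (Suc k) = 0" using no a_nonneg by (metis less_eq_real_def)
    then show ?thesis using vanish[of k] vanish[of "Suc k"] by auto
  qed
  have "summable (\<lambda>k. \<bar>q k\<bar> + \<bar>q (Suc k)\<bar>)"
    using summable_q by (intro summable_add) (simp_all add: summable_Suc_iff[of "\<lambda>k. \<bar>q k\<bar>"])
  then have "summable (\<lambda>k. c / real (Suc k))"
  proof (rule summable_comparison_test')
    fix k :: nat assume "1 \<le> k"
    from lower[OF this] show "norm (c / real (Suc k)) \<le> \<bar>q k\<bar> + \<bar>q (Suc k)\<bar>"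
      using c by (simp del: of_nat_Suc)
  qed
  from summable_mult[OF this, of "1 / c"] c have "summable (\<lambda>k. inverse (real (Suc k)))"
    by (simp add: inverse_eq_divide)
  then have "summable (\<lambda>k. inverse (real k))"
    by (rule summable_Suc_iff[of "\<lambda>k. inverse (real k)", THEN iffD1])
  with not_summable_harmonic[where ?'a = real] show False by contradiction
qed

section \<open>Decay of the modulus\<close>

text \<open>Isolate two consecutive atoms: the other terms contribute at most their total mass, and
  the two atoms strictly less than theirs, because \<open>cos x < 1\<close> for
  \<open>0 < \<bar>x\<bar> \<le> 4\<close>.\<close>

lemma norm_phi_less_1:
  assumes x: "x \<noteq> 0" "\<bar>x\<bar> \<le> 4"
  shows "norm (\<phi> x) < 1"
proof -
  obtain k where k: "a k > 0" "a (Suc k) > 0" using consecutive_support by blast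
  define b where "b j = (if j = k \<or> j = Suc k then a j else 0)" for j
  define r where "r j = a j - b j" for j
  let ?e = "\<lambda>j. cis (- (real j * x))"
  have b_sums: "(\<lambda>j. b j * z j) sums (a k * z k + a (Suc k) * z (Suc k))" for z :: "nat \<Rightarrow> complex"
    using sums_finite[of "{k, Suc k}" "\<lambda>j. b j * z j"] by (auto simp: b_def)
  have phi_sums: "(\<lambda>j. a j * ?e j) sums \<phi> x"
    unfolding \<phi>_def fourier_nat_def by (intro summable_sums summable_fourier_nat summable_a)
  have r_sums: "(\<lambda>j. r j * ?e j) sums (\<phi> x - (a k * ?e k + a (Suc k) * ?e (Suc k)))"
    using sums_diff[OF phi_sums b_sums[of ?e]] by (simp add: r_def left_diff_distrib)
  have "(\<lambda>j. complex_of_real (b j)) sums of_real (a k + a (Suc k))"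
    using b_sums[of "\<lambda>_. 1"] by simp
  then have "b sums (a k + a (Suc k))" by (simp only: sums_of_real_iff)
  from sums_diff[OF a_sums this] have rs: "r sums (1 - (a k + a (Suc k)))" by (simp add: r_def[abs_def])
  have r_nonneg: "r j \<ge> 0" for j using a_nonneg by (simp add: r_def b_def)
  have sr: "summable (\<lambda>j. norm (r j * ?e j))"
    using rs r_nonneg by (simp add: norm_mult sums_iff)
  have "norm (\<phi> x - (a k * ?e k + a (Suc k) * ?e (Suc k))) \<le> 1 - (a k + a (Suc k))"
    using summable_norm[OF sr] r_sums rs r_nonneg by (simp add: norm_mult sums_iff)
  moreover have "norm (a k * ?e k + a (Suc k) * ?e (Suc k)) < a k + a (Suc k)"
  proof -
    have "a k * ?e k + a (Suc k) * ?e (Suc k) = ?e k * (a k + a (Suc k) * cis (- x))"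
      by (simp add: algebra_simps cis_mult)
    then have "norm (a k * ?e k + a (Suc k) * ?e (Suc k)) = norm (a k + a (Suc k) * cis (- x))"
      by (simp add: norm_mult)
    moreover have "(norm (a k + a (Suc k) * cis (- x)))\<^sup>2 < (a k + a (Suc k))\<^sup>2"
    proof -
      have "x\<^sup>2 / 18 > 0" using x by simp
      then have cos1: "cos x < 1" using one_minus_cos_ge[OF x(2)] by linarith
      have "(norm (a k + a (Suc k) * cis (- x)))\<^sup>2 =
          (a k)\<^sup>2 + (a (Suc k))\<^sup>2 * ((cos x)\<^sup>2 + (sin x)\<^sup>2) + 2 * (a k * a (Suc k)) * cos x"
        unfolding cmod_power2 by (simp add: power2_eq_square algebra_simps del: sin_cos_squared_add sin_cos_squared_add2 sin_cos_squared_add3)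
      also have "\<dots> < (a k)\<^sup>2 + (a (Suc k))\<^sup>2 + 2 * (a k * a (Suc k)) * 1"
        using k cos1 mult_strict_left_mono[OF cos1, of "2 * (a k * a (Suc k))"] by simp
      finally show ?thesis by (simp add: power2_sum)
    qed
    ultimately show ?thesis using k by (auto intro: power2_less_imp_less)
  qed
  ultimately show ?thesis
    using norm_triangle_ineq2[of "\<phi> x" "a k * ?e k + a (Suc k) * ?e (Suc k)"] by linarith
qed

text \<open>Near \<open>0\<close> the squared modulus is \<open>1 - 2 * (1 - Re \<phi>)\<close> plus
  the square of \<open>norm (1 - \<phi>)\<close>, and the latter, of order
  \<open>\<bar>x\<bar> powr (2 * \<alpha>)\<close>, is of higher order. Away from \<open>0\<close>,
  compactness turns \<open>norm_phi_less_1\<close> into a uniform gap.\<close>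

lemma phi_decay:
  obtains \<kappa> where "\<kappa> > 0" "\<And>x. \<bar>x\<bar> < 4 \<Longrightarrow> norm (\<phi> x) \<le> exp (- \<kappa> * \<bar>x\<bar> powr \<alpha>)"
proof -
  obtain \<epsilon> where eps: "0 < \<epsilon>" "\<epsilon> < 1" "\<And>x. \<bar>x\<bar> \<le> \<epsilon> \<Longrightarrow> \<epsilon> * \<bar>x\<bar> powr \<alpha> \<le> 1 - Re (\<phi> x)"
    using Re_phi_lower_bound by blast
  define C2 where "C2 = C1 / \<alpha>"
  have C2: "C2 > 0" using C1_pos alpha by (simp add: C2_def)
  \<comment> \<open>Ensures
    \<open>C2\<^sup>2 * \<bar>x\<bar> powr \<alpha> \<le> \<epsilon>\<close>, so that the quadratic
    term uses up only half of the gain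
    \<open>2 * \<epsilon> * \<bar>x\<bar> powr \<alpha>\<close>.\<close>
  define \<delta> where "\<delta> = min \<epsilon> ((\<epsilon> / C2\<^sup>2) powr (1 / \<alpha>))"
  have delta: "0 < \<delta>" "\<delta> \<le> \<epsilon>" "\<delta> \<le> (\<epsilon> / C2\<^sup>2) powr (1 / \<alpha>)"
    using eps C2 by (auto simp: \<delta>_def)
  have near: "norm (\<phi> x) \<le> exp (- (\<epsilon> / 2) * \<bar>x\<bar> powr \<alpha>)" if x: "\<bar>x\<bar> \<le> \<delta>" for x
  proof -
    let ?t = "\<bar>x\<bar> powr \<alpha>"
    have "?t \<le> ((\<epsilon> / C2\<^sup>2) powr (1 / \<alpha>)) powr \<alpha>"
      using x delta alpha by (intro powr_mono2) auto
    also have "\<dots> = \<epsilon> / C2\<^sup>2" using alpha eps C2 by (simp add: powr_powr)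
    finally have "C2\<^sup>2 * ?t \<le> \<epsilon>" using C2 by (simp add: field_simps)
    then have "C2\<^sup>2 * ?t * ?t \<le> \<epsilon> * ?t" by (rule mult_right_mono) simp
    moreover have "(norm (1 - \<phi> x))\<^sup>2 \<le> (C2 * ?t)\<^sup>2"
      using phi_holder[of x] x delta eps by (intro power_mono) (auto simp: C2_def)
    ultimately have "(norm (1 - \<phi> x))\<^sup>2 \<le> \<epsilon> * ?t" by (simp add: power2_eq_square mult_ac)
    moreover have "(norm (\<phi> x))\<^sup>2 = 1 - 2 * (1 - Re (\<phi> x)) + (norm (1 - \<phi> x))\<^sup>2"
      unfolding cmod_power2 by (simp add: power2_eq_square algebra_simps)
    ultimately have "(norm (\<phi> x))\<^sup>2 \<le> 1 + - (\<epsilon> * ?t)"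
      using eps(3)[of x] x delta by simp
    also have "\<dots> \<le> exp (- (\<epsilon> * ?t))" by (rule exp_ge_add_one_self)
    also have "\<dots> = (exp (- (\<epsilon> / 2) * ?t))\<^sup>2"
      by (simp add: power2_eq_square exp_add[symmetric])
    finally show ?thesis by (rule power2_le_imp_le) simp
  qed
  define S where "S = {-4..-\<delta>} \<union> {\<delta>..4}"
  have "compact S" "S \<noteq> {}" using delta eps by (auto simp: S_def)
  moreover have "continuous_on S (\<lambda>x. norm (\<phi> x))"
    by (intro continuous_intros continuous_phi)
  ultimately obtain y where y: "y \<in> S" "\<And>x. x \<in> S \<Longrightarrow> norm (\<phi> x) \<le> norm (\<phi> y)"
    using continuous_attains_sup[of S "\<lambda>x. norm (\<phi> x)"] by metis
  define \<eta> where "\<eta> = 1 - norm (\<phi> y)"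
  have eta: "\<eta> > 0" using norm_phi_less_1[of y] y delta by (auto simp: \<eta>_def S_def)
  \<comment> \<open>The divisor \<open>4\<close> is an upper bound for
    \<open>\<bar>x\<bar> powr \<alpha>\<close> on this range.\<close>
  have far: "norm (\<phi> x) \<le> exp (- (\<eta> / 4) * \<bar>x\<bar> powr \<alpha>)" if x: "\<delta> \<le> \<bar>x\<bar>" "\<bar>x\<bar> < 4" for x
  proof -
    have "\<bar>x\<bar> powr \<alpha> \<le> 4 powr \<alpha>" using x alpha by (intro powr_mono2) auto
    also have "\<dots> \<le> 4 powr 1" using alpha by (intro powr_mono) auto
    finally have "\<eta> / 4 * \<bar>x\<bar> powr \<alpha> \<le> \<eta> / 4 * 4" using eta by (intro mult_left_mono) auto
    then have "exp (- \<eta>) \<le> exp (- (\<eta> / 4) * \<bar>x\<bar> powr \<alpha>)" by simp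
    moreover have "norm (\<phi> x) \<le> 1 + - \<eta>"
    proof -
      have "x \<in> S" using x by (cases "x \<ge> 0") (auto simp: S_def)
      from y(2)[OF this] show ?thesis by (simp add: \<eta>_def)
    qed
    moreover have "1 + - \<eta> \<le> exp (- \<eta>)" by (rule exp_ge_add_one_self)
    ultimately show ?thesis by linarith
  qed
  define \<kappa> where "\<kappa> = min (\<epsilon> / 2) (\<eta> / 4)"
  show thesis
  proof (rule that[of \<kappa>])
    show "\<kappa> > 0" using eps eta by (simp add: \<kappa>_def)
    fix x :: real assume x: "\<bar>x\<bar> < 4"
    have weaken: "exp (- b * \<bar>x\<bar> powr \<alpha>) \<le> exp (- \<kappa> * \<bar>x\<bar> powr \<alpha>)" if "\<kappa> \<le> b" for b
      using that mult_right_mono[OF that, of "\<bar>x\<bar> powr \<alpha>"] by simp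
    show "norm (\<phi> x) \<le> exp (- \<kappa> * \<bar>x\<bar> powr \<alpha>)"
    proof (cases "\<bar>x\<bar> \<le> \<delta>")
      case True
      then show ?thesis using order_trans[OF near weaken] by (simp add: \<kappa>_def)
    next
      case False
      then show ?thesis using order_trans[OF far weaken] x by (simp add: \<kappa>_def)
    qed
  qed
qed

end

subsection \<open>Powers of the characteristic function\<close>

text \<open>The chosen \<open>B\<close> is the maximum, taken at \<open>t = p / \<kappa>\<close>; it
  follows from \<open>ln y \<le> y - 1\<close> at \<open>y = \<kappa> * t / p\<close>.\<close>

lemma powr_times_exp_bounded:
  fixes p \<kappa> :: real
  assumes "p > 0" "\<kappa> > 0"
  obtains B where "B > 0" "\<And>t. t \<ge> 0 \<Longrightarrow> t powr p * exp (- \<kappa> * t) \<le> B"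
proof
  define B where "B = exp (- p - p * ln (\<kappa> / p))"
  show "B > 0" by (simp add: B_def)
  fix t :: real assume "t \<ge> 0"
  show "t powr p * exp (- \<kappa> * t) \<le> B"
  proof (cases "t = 0")
    case False
    with \<open>t \<ge> 0\<close> have t: "t > 0" by simp
    have "ln (\<kappa> / p * t) \<le> \<kappa> / p * t - 1"
      using t assms by (intro ln_le_minus_one) auto
    moreover have "ln (\<kappa> / p * t) = ln (\<kappa> / p) + ln t"
      using t assms by (intro ln_mult_pos) auto
    ultimately have "p * ln t \<le> p * (\<kappa> / p * t - 1 - ln (\<kappa> / p))"
      using assms by (intro mult_left_mono) auto
    also have "\<dots> = \<kappa> * t - p - p * ln (\<kappa> / p)" using assms by (simp add: algebra_simps)
    finally have "exp (p * ln t + - \<kappa> * t) \<le> B" by (simp add: B_def)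
    then show ?thesis using t exp_add[of "p * ln t" "- \<kappa> * t"] by (simp add: powr_def)
  qed (simp add: B_def)
qed

context heavy_tail begin

text \<open>Both estimates are in terms of \<open>t = n * \<bar>x\<bar> powr \<alpha>\<close>: the factors \<open>exp (- \<kappa> * t)\<close> coming from
  \<open>\<phi> ^ n\<close> absorb every power of \<open>t\<close>.\<close>

lemma power_difference_bounds:
  obtains A B where "A > 0" "B > 0"
    "\<And>n x. n \<ge> 1 \<Longrightarrow> x \<noteq> 0 \<Longrightarrow> \<bar>x\<bar> < 4 \<Longrightarrow>
       norm (\<phi>' x * (of_nat n * \<phi> x ^ (n - 1) * (1 - \<phi> x) - \<phi> x ^ n))
         \<le> A * real n powr (- 1 / 2) * \<bar>x\<bar> powr (\<alpha> / 2 - 1)"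
    "\<And>n K x. n \<ge> 1 \<Longrightarrow> \<bar>x\<bar> < 4 \<Longrightarrow> real K \<le> 2 * real n powr (1 / \<alpha>) \<Longrightarrow>
       norm (\<phi> x ^ n * (1 - \<phi> x)) \<le> B / real n / (1 + (real K * x)\<^sup>2)"
proof -
  obtain \<kappa> where kappa: "\<kappa> > 0" "\<And>x. \<bar>x\<bar> < 4 \<Longrightarrow> norm (\<phi> x) \<le> exp (- \<kappa> * \<bar>x\<bar> powr \<alpha>)"
    using phi_decay by blast
  \<comment> \<open>The exponents \<open>3 / 2\<close> and \<open>1 / 2\<close> occur in the
    derivative estimate, as \<open>t powr (1 / 2)\<close> times \<open>t\<close> and times
    \<open>1\<close>; \<open>1\<close> and \<open>1 + 2 / \<alpha>\<close> occur in the size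
    estimate, the latter through \<open>(K * x)\<^sup>2\<close>.\<close>
  obtain B1 where B1: "B1 > 0" "\<And>t. t \<ge> 0 \<Longrightarrow> t powr (3 / 2) * exp (- \<kappa> * t) \<le> B1"
    by (rule powr_times_exp_bounded[of "3 / 2" \<kappa>]) (use kappa in auto)
  obtain B2 where B2: "B2 > 0" "\<And>t. t \<ge> 0 \<Longrightarrow> t powr (1 / 2) * exp (- \<kappa> * t) \<le> B2"
    by (rule powr_times_exp_bounded[of "1 / 2" \<kappa>]) (use kappa in auto)
  obtain B3 where B3: "B3 > 0" "\<And>t. t \<ge> 0 \<Longrightarrow> t powr 1 * exp (- \<kappa> * t) \<le> B3"
    by (rule powr_times_exp_bounded[of 1 \<kappa>]) (use kappa in auto)
  obtain B4 where B4: "B4 > 0" "\<And>t. t \<ge> 0 \<Longrightarrow> t powr (1 + 2 / \<alpha>) * exp (- \<kappa> * t) \<le> B4"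
    by (rule powr_times_exp_bounded[of "1 + 2 / \<alpha>" \<kappa>]) (use kappa alpha in \<open>auto simp: add_pos_pos\<close>)
  define C2 where "C2 = C1 / \<alpha>"
  have C2: "C2 > 0" using C1_pos alpha by (simp add: C2_def)
  \<comment> \<open>Pays for having only \<open>n - 1\<close> factors of \<open>\<phi>\<close>
    instead of \<open>n\<close>, given that
    \<open>\<bar>x\<bar> powr \<alpha> \<le> 4\<close>.\<close>
  define E where "E = exp (4 * \<kappa>)"
  have E: "E > 0" by (simp add: E_def)
  have pow: "norm (\<phi> x) ^ n \<le> exp (- \<kappa> * (real n * \<bar>x\<bar> powr \<alpha>))" if "\<bar>x\<bar> < 4" for x n
  proof -
    have "norm (\<phi> x) ^ n \<le> exp (- \<kappa> * \<bar>x\<bar> powr \<alpha>) ^ n"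
      by (intro power_mono kappa that) simp
    also have "\<dots> = exp (- \<kappa> * (real n * \<bar>x\<bar> powr \<alpha>))"
      by (simp add: exp_of_nat_mult[symmetric] mult_ac)
    finally show ?thesis .
  qed
  show thesis
  proof (rule that[of "C1 * (E * C2 * B1 + B2)" "C2 * (B3 + 4 * B4)"])
    show "C1 * (E * C2 * B1 + B2) > 0" "C2 * (B3 + 4 * B4) > 0"
      using C1_pos E C2 B1 B2 B3 B4 by (auto intro!: mult_pos_pos add_pos_pos)
  next
    fix n :: nat and x :: real assume n: "n \<ge> 1" and x: "x \<noteq> 0" "\<bar>x\<bar> < 4"
    define u where "u = \<bar>x\<bar> powr \<alpha>"
    define t where "t = real n * u"
    have u: "0 < u" "u \<le> 4"
    proof -
      have "u \<le> 4 powr \<alpha>" unfolding u_def using x alpha by (intro powr_mono2) auto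
      also have "\<dots> \<le> 4 powr 1" using alpha by (intro powr_mono) auto
      finally show "u \<le> 4" by simp
      show "0 < u" using x by (simp add: u_def)
    qed
    have t: "t > 0" using u n by (simp add: t_def)
    have "norm (\<phi> x) ^ (n - 1) \<le> exp (- \<kappa> * (real (n - 1) * u))"
      using pow[OF x(2)] by (simp add: u_def)
    also have "\<dots> = exp (\<kappa> * u) * exp (- \<kappa> * t)"
      using n by (simp add: t_def exp_add[symmetric] of_nat_diff algebra_simps)
    also have "\<dots> \<le> E * exp (- \<kappa> * t)"
      unfolding E_def using u kappa(1) by (intro mult_right_mono) auto
    finally have pow1: "norm (\<phi> x) ^ (n - 1) \<le> E * exp (- \<kappa> * t)" .
    have "norm (of_nat n * \<phi> x ^ (n - 1) * (1 - \<phi> x) - \<phi> x ^ n) \<le>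
        real n * norm (\<phi> x) ^ (n - 1) * norm (1 - \<phi> x) + norm (\<phi> x) ^ n"
      by (rule order_trans[OF norm_triangle_ineq4]) (simp add: norm_mult norm_power)
    also have "\<dots> \<le> real n * (E * exp (- \<kappa> * t)) * (C2 * u) + exp (- \<kappa> * t)"
      using pow1 pow[OF x(2), of n] phi_holder[OF x(2)] E
      by (intro add_mono mult_mono) (auto simp: u_def t_def C2_def)
    also have "\<dots> = (E * C2 * t + 1) * exp (- \<kappa> * t)"
      by (simp add: t_def algebra_simps)
    finally have fac: "norm (of_nat n * \<phi> x ^ (n - 1) * (1 - \<phi> x) - \<phi> x ^ n) \<le> (E * C2 * t + 1) * exp (- \<kappa> * t)" .
    \<comment> \<open>Borrowing half a power of \<open>t\<close> produces the factor
      \<open>n powr (- 1 / 2)\<close> and changes the exponent to \<open>s = \<alpha> / 2\<close>,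
      which is below \<open>1 / 2\<close> as the dyadic block estimate demands.\<close>
    have x_powr: "\<bar>x\<bar> powr (\<alpha> - 1) = real n powr (- 1 / 2) * \<bar>x\<bar> powr (\<alpha> / 2 - 1) * t powr (1 / 2)"
    proof -
      have "t powr (1 / 2) = real n powr (1 / 2) * \<bar>x\<bar> powr (\<alpha> / 2)"
        using u by (simp add: t_def u_def powr_mult powr_powr)
      then have "real n powr (- 1 / 2) * \<bar>x\<bar> powr (\<alpha> / 2 - 1) * t powr (1 / 2) =
          (real n powr (- 1 / 2) * real n powr (1 / 2)) * (\<bar>x\<bar> powr (\<alpha> / 2 - 1) * \<bar>x\<bar> powr (\<alpha> / 2))"
        by (simp only: mult_ac)
      also have "real n powr (- 1 / 2) * real n powr (1 / 2) = 1"
        using n by (simp add: powr_add[symmetric])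
      also have "\<bar>x\<bar> powr (\<alpha> / 2 - 1) * \<bar>x\<bar> powr (\<alpha> / 2) = \<bar>x\<bar> powr (\<alpha> - 1)"
        by (simp add: powr_add[symmetric])
      finally show ?thesis by simp
    qed
    have "norm (\<phi>' x * (of_nat n * \<phi> x ^ (n - 1) * (1 - \<phi> x) - \<phi> x ^ n)) \<le>
        C1 * \<bar>x\<bar> powr (\<alpha> - 1) * ((E * C2 * t + 1) * exp (- \<kappa> * t))"
      unfolding norm_mult[of "\<phi>' x"]
      using phi'_bound[of x] x fac C1_pos by (intro mult_mono) auto
    also have "\<dots> = C1 * (real n powr (- 1 / 2) * \<bar>x\<bar> powr (\<alpha> / 2 - 1)) *
        (E * C2 * (t powr (3 / 2) * exp (- \<kappa> * t)) + t powr (1 / 2) * exp (- \<kappa> * t))"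
    proof -
      have "t powr (3 / 2) = t powr (1 / 2) * t"
        using t powr_add[of t "1 / 2" 1] by simp
      then show ?thesis unfolding x_powr by (simp add: algebra_simps)
    qed
    also have "\<dots> \<le> C1 * (real n powr (- 1 / 2) * \<bar>x\<bar> powr (\<alpha> / 2 - 1)) * (E * C2 * B1 + B2)"
      using C1_pos E C2 B1(2)[of t] B2(2)[of t] t
      by (intro mult_left_mono add_mono) auto
    finally show "norm (\<phi>' x * (of_nat n * \<phi> x ^ (n - 1) * (1 - \<phi> x) - \<phi> x ^ n)) \<le>
        C1 * (E * C2 * B1 + B2) * real n powr (- 1 / 2) * \<bar>x\<bar> powr (\<alpha> / 2 - 1)"
      by (simp add: mult_ac)
  next
    fix n K :: nat and x :: real
    assume n: "n \<ge> 1" and x: "\<bar>x\<bar> < 4" and K: "real K \<le> 2 * real n powr (1 / \<alpha>)"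
    define t where "t = real n * \<bar>x\<bar> powr \<alpha>"
    have t: "t \<ge> 0" by (simp add: t_def)
    have "norm (\<phi> x ^ n * (1 - \<phi> x)) \<le> exp (- \<kappa> * t) * (C2 * \<bar>x\<bar> powr \<alpha>)"
      unfolding norm_mult norm_power using pow[OF x, of n] phi_holder[OF x]
      by (intro mult_mono) (auto simp: t_def C2_def)
    also have "\<dots> = C2 / real n * (t * exp (- \<kappa> * t))" using n by (simp add: t_def)
    finally have g: "norm (\<phi> x ^ n * (1 - \<phi> x)) \<le> C2 / real n * (t * exp (- \<kappa> * t))" .
    have "(real K * x)\<^sup>2 = (real K * \<bar>x\<bar>)\<^sup>2" by (simp add: power_mult_distrib)
    also have "\<dots> \<le> (2 * real n powr (1 / \<alpha>) * \<bar>x\<bar>)\<^sup>2"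
      using K by (intro power_mono mult_right_mono) auto
    also have "2 * real n powr (1 / \<alpha>) * \<bar>x\<bar> = 2 * t powr (1 / \<alpha>)"
      using alpha by (simp add: t_def powr_mult powr_powr)
    also have "(2 * t powr (1 / \<alpha>))\<^sup>2 = 4 * t powr (2 / \<alpha>)"
      by (simp add: power_mult_distrib power2_eq_square powr_add[symmetric])
    finally have Kx: "(real K * x)\<^sup>2 \<le> 4 * t powr (2 / \<alpha>)" .
    have "norm (\<phi> x ^ n * (1 - \<phi> x)) * (1 + (real K * x)\<^sup>2) \<le>
        C2 / real n * (t * exp (- \<kappa> * t)) * (1 + 4 * t powr (2 / \<alpha>))"
      using g Kx C2 t by (intro mult_mono) auto
    also have "\<dots> = C2 / real n * (t powr 1 * exp (- \<kappa> * t) + 4 * (t powr (1 + 2 / \<alpha>) * exp (- \<kappa> * t)))"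
      using t by (simp add: powr_add algebra_simps)
    also have "\<dots> \<le> C2 / real n * (B3 + 4 * B4)"
      using C2 B3(2)[OF t] B4(2)[OF t] by (intro mult_left_mono add_mono) auto
    finally show "norm (\<phi> x ^ n * (1 - \<phi> x)) \<le> C2 * (B3 + 4 * B4) / real n / (1 + (real K * x)\<^sup>2)"
      by (subst pos_le_divide_eq) (simp_all add: add_pos_nonneg)
  qed
qed

text \<open>Cut at \<open>K\<close>, the ceiling of \<open>n powr (1 / \<alpha>)\<close>. The head
  costs \<open>B / n\<close>; in the tail \<open>M\<close> and
  \<open>K powr (- \<alpha> / 2)\<close> each supply a factor \<open>n powr (- 1 / 2)\<close>. The
  constant is independent of \<open>n\<close>, \<open>f\<close> and \<open>m\<close>.\<close>

lemma l1_norm_power_difference: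
  obtains A where
    "\<And>n f m. n \<ge> 1 \<Longrightarrow> summable (\<lambda>k. norm (f k)) \<Longrightarrow>
       (\<And>x. fourier_nat f x = \<phi> x ^ n * (1 - \<phi> x)) \<Longrightarrow> (\<Sum>k<m. norm (f k)) \<le> A / real n"
proof -
  obtain A B where A: "A > 0" and B: "B > 0"
    and deriv_bound: "\<And>n x. n \<ge> 1 \<Longrightarrow> x \<noteq> 0 \<Longrightarrow> \<bar>x\<bar> < 4 \<Longrightarrow>
       norm (\<phi>' x * (of_nat n * \<phi> x ^ (n - 1) * (1 - \<phi> x) - \<phi> x ^ n))
         \<le> A * real n powr (- 1 / 2) * \<bar>x\<bar> powr (\<alpha> / 2 - 1)"
    and size_bound: "\<And>n K x. n \<ge> 1 \<Longrightarrow> \<bar>x\<bar> < 4 \<Longrightarrow> real K \<le> 2 * real n powr (1 / \<alpha>) \<Longrightarrow>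
       norm (\<phi> x ^ n * (1 - \<phi> x)) \<le> B / real n / (1 + (real K * x)\<^sup>2)"
    by (rule power_difference_bounds) blast
  \<comment> \<open>The constant has to be fixed before \<open>n\<close> and \<open>f\<close> are;
    this is possible because \<open>block_const\<close> depends on the exponent alone.\<close>
  define T where "T = singular_fourier_nat.block_const (\<alpha> / 2) / (1 - 2 powr (- (\<alpha> / 2)))"
  show thesis
  proof (rule that[of "B + T * A"])
    fix n m :: nat and f :: "nat \<Rightarrow> complex"
    assume n: "n \<ge> 1" and f: "summable (\<lambda>k. norm (f k))"
      and ff: "\<And>x. fourier_nat f x = \<phi> x ^ n * (1 - \<phi> x)"
    define g' where "g' x = \<phi>' x * (of_nat n * \<phi> x ^ (n - 1) * (1 - \<phi> x) - \<phi> x ^ n)" for x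
    interpret singular_fourier_nat f g' "A * real n powr (- 1 / 2)" "\<alpha> / 2"
    proof
      show "continuous_on UNIV (fourier_nat f)" by (rule continuous_on_fourier_nat[OF f])
      fix x :: real assume x: "x \<noteq> 0" "\<bar>x\<bar> < 4"
      have "((\<lambda>z. z ^ n * (1 - z)) \<circ> \<phi> has_vector_derivative g' x) (at x)"
        unfolding g'_def
        by (rule field_vector_diff_chain_at[OF phi_has_vector_derivative[OF x]])
           (auto intro!: derivative_eq_intros simp: algebra_simps)
      moreover have "fourier_nat f = (\<lambda>z. z ^ n * (1 - z)) \<circ> \<phi>" using ff by auto
      ultimately show "(fourier_nat f has_vector_derivative g' x) (at x)" by simp
      show "norm (g' x) \<le> A * real n powr (- 1 / 2) * \<bar>x\<bar> powr (\<alpha> / 2 - 1)"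
        unfolding g'_def by (rule deriv_bound[OF n x])
    qed (use alpha A f in auto)
    define K where "K = nat \<lceil>real n powr (1 / \<alpha>)\<rceil>"
    have n1: "real n powr (1 / \<alpha>) \<ge> 1" using n alpha by (simp add: ge_one_powr_ge_zero)
    then have K: "real n powr (1 / \<alpha>) \<le> real K" "real K \<le> 2 * real n powr (1 / \<alpha>)" "K \<ge> 1"
      unfolding K_def by linarith+
    have head: "(\<Sum>k<K. norm (f k)) \<le> B / real n"
    proof (rule sum_head_le[OF f K(3)])
      fix x assume "x \<in> {-pi..pi}"
      then have "\<bar>x\<bar> < 4" using pi_less_4 by auto
      then show "norm (fourier_nat f x) \<le> B / real n / (1 + (real K * x)\<^sup>2)"
        unfolding ff by (rule size_bound[OF n _ K(2)])
    qed (use B in auto)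
    have "0 \<le> block_const" using alpha by (simp add: block_const_def)
    then have T: "T \<ge> 0" unfolding T_def using alpha by (simp add: powr_le_one_le powr_minus_divide ge_one_powr_ge_zero)
    have "(\<Sum>k=K..<m. norm (f k)) \<le> T * (A * real n powr (- 1 / 2)) * real K powr (- (\<alpha> / 2))"
      unfolding T_def by (rule sum_tail_le[OF K(3)])
    also have "\<dots> \<le> T * (A * real n powr (- 1 / 2)) * (real n powr (1 / \<alpha>)) powr (- (\<alpha> / 2))"
      using T A K n n1 alpha by (intro mult_left_mono powr_mono2') auto
    also have "(real n powr (1 / \<alpha>)) powr (- (\<alpha> / 2)) = real n powr (- 1 / 2)"
      using alpha by (simp add: powr_powr)
    also have "T * (A * real n powr (- 1 / 2)) * real n powr (- 1 / 2) = T * A / real n"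
      using n by (simp add: powr_add[symmetric] powr_minus_divide mult.assoc)
    finally have tail: "(\<Sum>k=K..<m. norm (f k)) \<le> T * A / real n" .
    have "(\<Sum>k<m. norm (f k)) \<le> (\<Sum>k\<in>{..<K} \<union> {K..<m}. norm (f k))"
      by (intro sum_mono2) auto
    also have "\<dots> = (\<Sum>k<K. norm (f k)) + (\<Sum>k=K..<m. norm (f k))"
      by (intro sum.union_disjoint) auto
    also have "\<dots> \<le> (B + T * A) / real n"
      using head tail by (simp add: add_divide_distrib)
    finally show "(\<Sum>k<m. norm (f k)) \<le> (B + T * A) / real n" .
  qed
qed

end

subsection \<open>Convolution powers\<close>

lemma has_sum_int_iff_nat:
  fixes f :: "int \<Rightarrow> 'a::{comm_monoid_add,topological_space}"
  assumes "\<And>k. k < 0 \<Longrightarrow> f k = 0"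
  shows "(f has_sum S) UNIV \<longleftrightarrow> ((\<lambda>n. f (int n)) has_sum S) UNIV"
proof -
  have "(f has_sum S) UNIV \<longleftrightarrow> (f has_sum S) (range int)"
  proof (rule has_sum_cong_neutral)
    fix k assume "k \<in> UNIV - range int"
    then have "k < 0" by (metis Diff_iff nat_0_le not_le rangeI)
    then show "f k = 0" by (rule assms)
  qed auto
  also have "\<dots> \<longleftrightarrow> ((f \<circ> int) has_sum S) UNIV"
    by (rule has_sum_reindex) simp
  finally show ?thesis by (simp add: o_def)
qed

text \<open>Passes from the unordered sums over \<open>int\<close> in the definitions to series over
  \<open>nat\<close>.\<close>

lemma infsum_int_eq_suminf:
  fixes f :: "int \<Rightarrow> 'a::banach"
  assumes "\<And>k. k < 0 \<Longrightarrow> f k = 0" and "summable (\<lambda>n. norm (f (int n)))"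
  shows "(\<Sum>\<^sub>\<infinity>k. f k) = (\<Sum>n. f (int n))"
proof -
  have "((\<lambda>n. f (int n)) has_sum (\<Sum>n. f (int n))) UNIV"
    by (rule norm_summable_imp_has_sum[OF assms(2) summable_sums[OF summable_norm_cancel[OF assms(2)]]])
  then have "(f has_sum (\<Sum>n. f (int n))) UNIV"
    by (subst has_sum_int_iff_nat[OF assms(1)])
  then show ?thesis by (rule infsumI)
qed

lemma fourier_eq_fourier_nat:
  assumes "\<And>k. k < 0 \<Longrightarrow> F k = 0" and "summable (\<lambda>n. \<bar>F (int n)\<bar>)"
  shows "fourier F = fourier_nat (\<lambda>n. of_real (F (int n)))"
proof
  fix x
  have "fourier F x = (\<Sum>n. complex_of_real (F (int n)) * exp (- \<i> * of_int (int n) * of_real x))"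
    unfolding fourier_def
    by (rule infsum_int_eq_suminf) (use assms in \<open>auto simp: norm_mult\<close>)
  then show "fourier F x = fourier_nat (\<lambda>n. of_real (F (int n))) x"
    by (simp add: fourier_nat_def cis_conv_exp mult.assoc)
qed

lemma conv_eq_sum:
  assumes f: "\<And>k. k < 0 \<Longrightarrow> f k = 0" and g: "\<And>k. k < 0 \<Longrightarrow> g k = 0"
  shows "conv f g m = (\<Sum>j\<in>{0..m}. f j * g (m - j))"
proof -
  have "conv f g m = (\<Sum>\<^sub>\<infinity>j\<in>{0..m}. f j * g (m - j))"
    unfolding conv_def by (rule infsum_cong_neutral) (use f g in auto)
  then show ?thesis by simp
qed

lemma conv_int:
  assumes f: "\<And>k. k < 0 \<Longrightarrow> f k = 0" and g: "\<And>k. k < 0 \<Longrightarrow> g k = 0"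
  shows "conv f g (int k) = (\<Sum>i\<le>k. f (int i) * g (int (k - i)))"
proof -
  have "conv f g (int k) = (\<Sum>j\<in>int ` {..k}. f j * g (int k - j))"
    by (subst conv_eq_sum) (use f g in \<open>auto simp: image_int_atLeastAtMost atMost_atLeast0\<close>)
  also have "\<dots> = (\<Sum>i\<le>k. f (int i) * g (int k - int i))"
    by (simp add: sum.reindex)
  finally have "conv f g (int k) = (\<Sum>i\<le>k. f (int i) * g (int k - int i))" .
  then show ?thesis by (simp add: of_nat_diff)
qed

context
  fixes F :: "int \<Rightarrow> real"
  assumes F: "prob_Zplus F"
begin

lemma prob_Zplus_neg: "k < 0 \<Longrightarrow> F k = 0"
  using F by (simp add: prob_Zplus_def)

lemma prob_Zplus_nonneg: "F k \<ge> 0"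
  using F by (simp add: prob_Zplus_def)

lemma prob_Zplus_sums: "(\<lambda>n. F (int n)) sums 1"
proof -
  have "(F has_sum 1) UNIV" using F by (simp add: prob_Zplus_def)
  then have "((\<lambda>n. F (int n)) has_sum 1) UNIV"
    by (subst has_sum_int_iff_nat[symmetric]) (auto intro: prob_Zplus_neg)
  then show ?thesis by (rule has_sum_imp_sums)
qed

lemma conv_pow_neg: "k < 0 \<Longrightarrow> conv_pow F n k = 0"
proof (induction n arbitrary: k)
  case (Suc n)
  then show ?case by (simp add: conv_eq_sum[of "conv_pow F n" F] prob_Zplus_neg)
qed (simp add: delta_def)

lemma conv_pow_nonneg: "conv_pow F n k \<ge> 0"
proof (induction n arbitrary: k)
  case (Suc n)
  then show ?case by (simp add: conv_eq_sum[OF conv_pow_neg prob_Zplus_neg] sum_nonneg prob_Zplus_nonneg)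
qed (simp add: delta_def)

text \<open>Both claims go through one induction, since the Cauchy product formula for the next
  transform needs absolute summability of the current power.\<close>

lemma conv_pow_transform:
  "summable (\<lambda>k. norm (complex_of_real (conv_pow F n (int k)))) \<and>
   fourier_nat (\<lambda>k. of_real (conv_pow F n (int k))) x = fourier_nat (\<lambda>k. of_real (F (int k))) x ^ n"
proof (induction n)
  case 0
  have "(\<lambda>k. complex_of_real (conv_pow F 0 (int k)) * z k) sums z 0" for z
    using sums_finite[of "{0}" "\<lambda>k. complex_of_real (conv_pow F 0 (int k)) * z k"]
    by (auto simp: delta_def)
  moreover have "summable (\<lambda>k. norm (complex_of_real (conv_pow F 0 (int k))))"
    by (rule summable_finite[of "{0}"]) (auto simp: delta_def)
  ultimately show ?case by (auto simp: fourier_nat_def sums_iff)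
next
  case (Suc n)
  let ?p = "\<lambda>n k. conv_pow F n (int k)"
  let ?a = "\<lambda>k. F (int k)"
  have conv: "?p (Suc n) k = (\<Sum>i\<le>k. ?p n i * ?a (k - i))" for k
    by (simp add: conv_int[OF conv_pow_neg prob_Zplus_neg])
  have sp: "summable (\<lambda>k. norm (?p n k))" using Suc by simp
  have sa: "summable (\<lambda>k. norm (?a k))" using prob_Zplus_sums prob_Zplus_nonneg by (simp add: sums_iff)
  \<comment> \<open>Plain summability is enough here, as nonnegativity upgrades it to absolute
    summability.\<close>
  have "summable (?p (Suc n))"
    unfolding conv using summable_Cauchy_product[OF sp sa] .
  then have "summable (\<lambda>k. norm (complex_of_real (?p (Suc n) k)))"
    using conv_pow_nonneg by (simp del: conv_pow.simps)
  moreover have "fourier_nat (\<lambda>k. of_real (?p (Suc n) k)) x =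
      fourier_nat (\<lambda>k. of_real (?p n k)) x * fourier_nat (\<lambda>k. of_real (?a k)) x"
  proof -
    let ?e = "\<lambda>k. cis (- (real k * x))"
    have "(\<Sum>k. complex_of_real (?p n k) * ?e k) * (\<Sum>k. complex_of_real (?a k) * ?e k) =
        (\<Sum>k. \<Sum>i\<le>k. (complex_of_real (?p n i) * ?e i) * (complex_of_real (?a (k - i)) * ?e (k - i)))"
      by (rule Cauchy_product) (use sp sa in \<open>simp_all add: norm_mult\<close>)
    also have "\<dots> = (\<Sum>k. complex_of_real (?p (Suc n) k) * ?e k)"
    proof (rule suminf_cong)
      fix k
      have "(complex_of_real (?p n i) * ?e i) * (complex_of_real (?a (k - i)) * ?e (k - i)) =
          complex_of_real (?p n i * ?a (k - i)) * ?e k" if "i \<le> k" for i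
      proof -
        have "?e i * ?e (k - i) = ?e k"
          using that by (simp add: cis_mult of_nat_diff algebra_simps)
        then show ?thesis by (metis (no_types, lifting) mult.assoc mult.left_commute of_real_mult)
      qed
      then show "(\<Sum>i\<le>k. (complex_of_real (?p n i) * ?e i) * (complex_of_real (?a (k - i)) * ?e (k - i))) =
          complex_of_real (?p (Suc n) k) * ?e k"
        unfolding conv of_real_sum sum_distrib_right by (intro sum.cong) auto
    qed
    finally show ?thesis by (simp only: fourier_nat_def)
  qed
  ultimately show ?case using Suc by (simp del: conv_pow.simps)
qed

end

section \<open>Aperiodicity and the final assembly\<close>

text \<open>Every translate again has two consecutive integers in its support, and their difference
  \<open>1\<close> generates the integers.\<close>

lemma aperiodic_of_consecutive_support:
  assumes k: "F k \<noteq> 0" "F (k + 1) \<noteq> 0"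
  shows "aperiodic F"
  unfolding aperiodic_def adapted_def
proof (intro allI impI)
  fix m :: int and H :: "int set"
  assume "0 \<in> H \<and> (\<forall>a\<in>H. \<forall>b\<in>H. a - b \<in> H) \<and> {k. conv (delta m) F k \<noteq> 0} \<subseteq> H"
  then have H: "0 \<in> H" "\<And>a b. a \<in> H \<Longrightarrow> b \<in> H \<Longrightarrow> a - b \<in> H"
    and supp: "\<And>k. conv (delta m) F k \<noteq> 0 \<Longrightarrow> k \<in> H" by auto
  have shift: "conv (delta m) F j = F (j - m)" for j
  proof -
    have "conv (delta m) F j = (\<Sum>\<^sub>\<infinity>i\<in>{m}. F (j - i))"
      unfolding conv_def by (rule infsum_cong_neutral) (auto simp: delta_def)
    then show ?thesis by simp
  qed
  have "k + m \<in> H" "k + 1 + m \<in> H" using supp k by (auto simp: shift)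
  from H(2)[OF this(2,1)] have one: "1 \<in> H" by simp
  from H(2)[OF H(1) this] have minus_one: "-1 \<in> H" by simp
  have "j \<in> H" for j
  proof (induction j rule: int_induct[where k = 0])
    case base
    then show ?case by (rule H(1))
  next
    case (step1 i)
    then show ?case using H(2)[OF step1(2) minus_one] by simp
  next
    case (step2 i)
    then show ?case using H(2)[OF step2(2) one] by simp
  qed
  then show "H = UNIV" by auto
qed

text \<open>The derivative bound includes existence of the derivative, two-sided even at
  \<open>pi\<close> and \<open>- pi\<close>; the working radius \<open>4 > pi\<close> provides
  this.\<close>

theorem theorem5p5:
  fixes F :: "int \<Rightarrow> real" and P :: "int \<Rightarrow> complex"
    and N :: nat and \<alpha> c :: "nat \<Rightarrow> real"
  assumes F: "prob_Zplus F"
    and N: "N \<ge> 1"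
    and alpha_pos: "0 < \<alpha> 1"
    and alpha_mono: "\<And>i j. 1 \<le> i \<Longrightarrow> i < j \<Longrightarrow> j \<le> N \<Longrightarrow> \<alpha> i < \<alpha> j"
    and alpha_lt1: "\<alpha> N < 1"
    and c_pos: "\<And>j. 1 \<le> j \<Longrightarrow> j \<le> N \<Longrightarrow> c j > 0"
    and P: "L1_Zplus P"
    and P_moment: "(\<lambda>k. real_of_int k * norm (P k)) summable_on {1..}"
    and F_eq: "\<And>k::int. k \<ge> 1 \<Longrightarrow>
       complex_of_real (F k) = (\<Sum>j=1..N. complex_of_real (c j * real_of_int k powr (-1 - \<alpha> j))) + P k"
  shows "aperiodic F \<and>
    (\<exists>\<epsilon> cc. 0 < \<epsilon> \<and> \<epsilon> < 1 \<and> cc > 0 \<and>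
       (\<forall>\<xi>\<in>{-\<epsilon>..\<epsilon>}. 1 - Re (fourier F \<xi>) \<ge> \<epsilon> * \<bar>\<xi>\<bar> powr \<alpha> 1) \<and>
       (\<forall>\<xi>\<in>{-pi..pi} - {0}. \<exists>D. (fourier F has_vector_derivative D) (at \<xi>) \<and>
             norm D \<le> cc * \<bar>\<xi>\<bar> powr (\<alpha> 1 - 1))) \<and>
    F \<in> classA"
proof -
  define a where "a k = F (int k)" for k
  define d where "d k = (\<Sum>j=1..N. c j * real k powr (- \<alpha> j))" for k
  have alpha_ge: "\<alpha> 1 \<le> \<alpha> j" if "j \<in> {1..N}" for j
    using alpha_mono[of 1 j] that by (cases "j = 1") auto
  have alpha1: "\<alpha> 1 < 1" using alpha_ge[of N] N alpha_lt1 by auto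
  have c_nonneg: "c j \<ge> 0" if "j \<in> {1..N}" for j
    using c_pos[of j] that by auto
  have rem: "summable (\<lambda>k. \<bar>real k * a k - d k\<bar>)"
  proof -
    have "(\<lambda>k. real_of_int k * norm (P k)) summable_on (int ` {1..})"
    proof -
      have "int ` {1..} = {1..}"
      proof (intro equalityI subsetI)
        fix k :: int assume "k \<in> {1..}"
        then show "k \<in> int ` {1..}" by (intro image_eqI[of _ _ "nat k"]) auto
      qed auto
      then show ?thesis using P_moment by simp
    qed
    then have "(\<lambda>k. real k * norm (P (int k))) summable_on {1..}"
      by (subst (asm) summable_on_reindex) (auto simp: o_def)
    \<comment> \<open>Index \<open>0\<close> may be added because the weight \<open>real k\<close>
      vanishes there.\<close>
    then have "(\<lambda>k. real k * norm (P (int k))) summable_on UNIV"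
      by (rule summable_on_cong_neutral[THEN iffD1, rotated -1]) (auto simp: not_le)
    then have "summable (\<lambda>k. real k * norm (P (int k)))"
      by (rule summable_on_imp_summable)
    then show ?thesis
    proof (rule summable_comparison_test')
      fix k :: nat assume k: "1 \<le> k"
      \<comment> \<open>\<open>P\<close> is complex-valued while \<open>F\<close> is real, so taking
        real parts replaces \<open>P\<close> by \<open>Re P\<close>, which is no larger in
        modulus.\<close>
      have "F (int k) = Re (complex_of_real (F (int k)))" by simp
      also have "\<dots> = (\<Sum>j=1..N. c j * real k powr (-1 - \<alpha> j)) + Re (P (int k))"
        using k by (subst F_eq) auto
      finally have "real k * a k - d k = real k * Re (P (int k))"
        using k by (simp add: a_def d_def distrib_left sum_distrib_left powr_diff powr_minus mult_ac field_simps)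
      then show "norm \<bar>real k * a k - d k\<bar> \<le> real k * norm (P (int k))"
        by (simp add: abs_mult mult_left_mono abs_Re_le_cmod)
    qed
  qed
  \<comment> \<open>The lower bound keeps only the summand \<open>j = 1\<close>; the upper bound
    replaces every exponent by the smallest, \<open>\<alpha> 1\<close>.\<close>
  interpret heavy_tail a d "\<alpha> 1" "c 1" "\<Sum>j=1..N. c j"
  proof
    show "a k \<ge> 0" for k by (simp add: a_def prob_Zplus_nonneg[OF F])
    show "a sums 1" using prob_Zplus_sums[OF F] by (simp add: a_def[abs_def])
    show "c 1 > 0" using c_pos N by simp
    fix k :: nat assume k: "k \<ge> 1"
    show "c 1 * real k powr (- \<alpha> 1) \<le> d k"
      unfolding d_def using N c_nonneg
      by (intro member_le_sum[of 1 "{1..N}" "\<lambda>j. c j * real k powr (- \<alpha> j)"]) auto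
    show "d k \<le> (\<Sum>j=1..N. c j) * real k powr (- \<alpha> 1)"
      unfolding d_def sum_distrib_right
      using k alpha_ge c_nonneg by (intro sum_mono mult_left_mono powr_mono) auto
    show "d (Suc k) \<le> d k"
      unfolding d_def
    proof (intro sum_mono mult_left_mono)
      fix j assume "j \<in> {1..N}"
      then have "0 \<le> \<alpha> j" using alpha_ge[of j] alpha_pos by simp
      then show "real (Suc k) powr (- \<alpha> j) \<le> real k powr (- \<alpha> j)"
        using k by (intro powr_mono2') auto
    qed (rule c_nonneg)
  qed (use alpha_pos alpha1 rem in auto)
  have fourier_eq: "fourier F = \<phi>"
    unfolding \<phi>_def a_def
    by (rule fourier_eq_fourier_nat)
       (use prob_Zplus_neg[OF F] prob_Zplus_sums[OF F] prob_Zplus_nonneg[OF F] in \<open>auto simp: sums_iff\<close>)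
  have "aperiodic F"
  proof -
    obtain k where "a k > 0" "a (Suc k) > 0" using consecutive_support by blast
    then show ?thesis
      by (intro aperiodic_of_consecutive_support[of F "int k"]) (auto simp: a_def add.commute)
  qed
  moreover obtain \<epsilon> where "0 < \<epsilon>" "\<epsilon> < 1" "\<And>x. \<bar>x\<bar> \<le> \<epsilon> \<Longrightarrow> \<epsilon> * \<bar>x\<bar> powr \<alpha> 1 \<le> 1 - Re (\<phi> x)"
    using Re_phi_lower_bound by blast
  moreover have "\<exists>D. (\<phi> has_vector_derivative D) (at \<xi>) \<and> norm D \<le> C1 * \<bar>\<xi>\<bar> powr (\<alpha> 1 - 1)"
    if "\<xi> \<in> {-pi..pi} - {0}" for \<xi>
  proof -
    have "\<xi> \<noteq> 0" "\<bar>\<xi>\<bar> < 4" using that pi_less_4 by auto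
    then show ?thesis using phi_has_vector_derivative[of \<xi>] phi'_bound[of \<xi>] by auto
  qed
  moreover have "F \<in> classA"
  proof -
    obtain A where A: "\<And>n f m. n \<ge> 1 \<Longrightarrow> summable (\<lambda>k. norm (f k)) \<Longrightarrow>
       (\<And>x. fourier_nat f x = \<phi> x ^ n * (1 - \<phi> x)) \<Longrightarrow> (\<Sum>k<m. norm (f k)) \<le> A / real n"
      using l1_norm_power_difference by blast
    have bound: "real n * (\<Sum>\<^sub>\<infinity>k. \<bar>conv_pow F n k - conv_pow F (Suc n) k\<bar>) \<le> A" if n: "n \<ge> 1" for n
    proof -
      let ?p = "\<lambda>n k. complex_of_real (conv_pow F n (int k))"
      define f where "f k = ?p n k - ?p (Suc n) k" for k
      have sp: "summable (\<lambda>k. norm (?p i k))" for i using conv_pow_transform[OF F] by blast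
      have p_eq: "fourier_nat (?p i) x = \<phi> x ^ i" for i x
        using conv_pow_transform[OF F] by (simp add: \<phi>_def a_def)
      have f: "summable (\<lambda>k. norm (f k))"
        by (rule summable_comparison_test'[OF summable_add[OF sp[of n] sp[of "Suc n"]]])
           (unfold f_def real_norm_def abs_norm_cancel, rule norm_triangle_ineq4)
      have "fourier_nat f x = \<phi> x ^ n * (1 - \<phi> x)" for x
      proof -
        have "fourier_nat f x = fourier_nat (?p n) x - fourier_nat (?p (Suc n)) x"
          unfolding fourier_nat_def f_def left_diff_distrib
          by (rule suminf_diff[symmetric]) (intro summable_fourier_nat sp)+
        then show ?thesis by (simp add: p_eq algebra_simps del: conv_pow.simps)
      qed
      note partial = A[OF n f this]
      have norm_f: "norm (f k) = \<bar>conv_pow F n (int k) - conv_pow F (Suc n) (int k)\<bar>" for k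
        unfolding f_def of_real_diff[symmetric] norm_of_real ..
      have "(\<Sum>\<^sub>\<infinity>k. \<bar>conv_pow F n k - conv_pow F (Suc n) k\<bar>) = (\<Sum>k. norm (f k))"
        unfolding norm_f
        by (rule infsum_int_eq_suminf)
           (use f in \<open>auto simp: norm_f conv_pow_neg[OF F] simp del: conv_pow.simps\<close>)
      also have "\<dots> \<le> A / real n"
        by (rule suminf_le_const[OF f partial])
      finally show ?thesis using n by (simp add: field_simps)
    qed
    \<comment> \<open>For \<open>n = 0\<close> the left side is \<open>0\<close>, and the sign of
      \<open>A\<close> is not known; hence the maximum.\<close>
    have "real n * (\<Sum>\<^sub>\<infinity>k. \<bar>conv_pow F n k - conv_pow F (Suc n) k\<bar>) \<le> max A 0" for n
      using bound[of n] by (cases "n = 0") (auto simp: le_max_iff_disj)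
    then show ?thesis using F by (auto simp: classA_def)
  qed
  ultimately show ?thesis unfolding fourier_eq using C1_pos
    by (intro conjI exI[of _ \<epsilon>] exI[of _ C1]) auto
qed

end
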